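(* Let $\pi:(E,\mathcal P)\to X$ be a diffeological vector pseudo-bundle. The vector pseudo-bundle $(E,\mathcal P_{\mathrm{Aut}(E)})$ (over $X$ equipped with $\mathcal P_{G_E(X)}$) has connected components with typical fiber; that is, for any two points $x,y\in X$ over which lie points of the same connected component of $(E,\mathcal P_{\mathrm{Aut}(E)})$, the fibers $E_x$ and $E_y$ are isomorphic as diffeological vector spaces.
   Context: A diffeological vector pseudo-bundle over a diffeological field $\mathbb K$ is a smooth surjective subduction $\pi:E\to X$ of diffeological spaces (the diffeology of $X$ is the push-forward of that of $E$, i.e. the smallest diffeology containing all $\pi\circ p$, $p$ a plot of $E$) with smooth fiberwise scalar multiplication $\mathbb K\times E\to E$ and addition $E\times_XE\to E$ making each fiber $E_x=\pi^{-1}(x)$ a diffeological vector space. No local triviality or typical fiber is assumed. $\mathrm{Aut}(E)$ is the group of pairs $(\phi,\varphi)$ with $\phi\in \mathrm{Diff}(E)$, $\varphi\in\mathrm{Diff}(X)$, $\pi\circ\phi=\varphi\circ\pi$ and $\phi$ fiberwise linear. $G_E(X)\subset\mathrm{Diff}(X)$ is the image of $\mathrm{Aut}(E)$ under $(\phi,\varphi)\mapsto\varphi$. $\mathrm{Aut}(E)$ is a diffeological subgroup of $\mathrm{Diff}(E)$, and $\mathrm{Diff}(Z)$ has the functional diffeology making evaluation and inversion smooth. The group $G_E(X)$ is equipped with its diffeology as a diffeological group (diffeological subgroup of $\mathrm{Diff}(X)$, quotient of $\mathrm{Aut}(E)$). For a diffeological group $G$ acting on a set $X$, $\mathcal P_G(X)$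 denotes the push-forward diffeology from $G$ on $X$: the smallest diffeology on $X$ containing all maps $u\mapsto g(u)\cdot x$ with $g$ a plot of $G$ and $x\in X$. It separates the orbits: disjoint orbits lie in different connected components. $\mathcal P_{G_E(X)}$ is the diffeology so obtained on $X$ from the action of $G_E(X)$. Finally $$\mathcal P_{\mathrm{Aut}(E)}=\mathcal P\cap\pi^*(\mathcal P_{G_E(X)}),$$ i.e. plots of $E$ whose composition with $\pi$ lies in $\mathcal P_{G_E(X)}$. Connected components are taken for the D-topology (finest topology making all plots continuous). *)

theory Defs
  imports
    "HOL-Analysis.Abstract_Euclidean_Space"
    "HOL-Analysis.Abstract_Topology_2"
    "HOL-Algebra.Module"
    "HOL-Algebra.Bij"
begin

section \<open>Smooth maps between Euclidean open sets of varying dimension\<close>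

text \<open>
  The dimension of the domain of a plot varies, so R^n is rendered by the library's
  \<^const>\<open>Euclidean_space\<close> \<open>n\<close>: the sequences \<open>x :: nat \<Rightarrow> real\<close> with \<open>x i = 0\<close> for all \<open>i \<ge> n\<close>.
\<close>

primrec C_diff :: "nat \<Rightarrow> nat \<Rightarrow> (nat \<Rightarrow> real) set \<Rightarrow> ((nat \<Rightarrow> real) \<Rightarrow> real) \<Rightarrow> bool" where
  "C_diff 0 n U f \<longleftrightarrow> continuous_map (subtopology (Euclidean_space n) U) euclideanreal f"
| "C_diff (Suc k) n U f \<longleftrightarrow>
     continuous_map (subtopology (Euclidean_space n) U) euclideanreal f \<and>
     (\<forall>i<n. \<exists>g. C_diff k n U g \<and>
        (\<forall>x\<in>U. ((\<lambda>t. f (x(i := t))) has_real_derivative g x) (at (x i))))"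

definition smooth_euclid ::
    "nat \<Rightarrow> (nat \<Rightarrow> real) set \<Rightarrow> nat \<Rightarrow> (nat \<Rightarrow> real) set \<Rightarrow> ((nat \<Rightarrow> real) \<Rightarrow> nat \<Rightarrow> real) \<Rightarrow> bool" where
  "smooth_euclid m V n U f \<longleftrightarrow>
     f \<in> V \<rightarrow> U \<and> (\<forall>i<n. \<forall>k. C_diff k m V (\<lambda>v. f v i))"


section \<open>Diffeological spaces\<close>

text \<open>
  A parametrization \<open>(n, U, p)\<close> consists of a dimension, an open set of R^n and a map on it.
  Maps are extensional, so that two parametrizations are equal iff they agree on their domain.
\<close>

type_synonym 'a param = "nat \<times> (nat \<Rightarrow> real) set \<times> ((nat \<Rightarrow> real) \<Rightarrow> 'a)"

record 'a diffspace =
  points :: "'a set"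
  plots :: "'a param set"

definition params :: "'a set \<Rightarrow> 'a param set" where
  "params A = {(n, U, p). openin (Euclidean_space n) U \<and> p \<in> U \<rightarrow>\<^sub>E A}"

definition diffeological_space :: "'a diffspace \<Rightarrow> bool" where
  "diffeological_space A \<longleftrightarrow>
     plots A \<subseteq> params (points A) \<and>
     \<comment> \<open>covering\<close>
     (\<forall>n U a. openin (Euclidean_space n) U \<and> a \<in> points A \<longrightarrow> (n, U, \<lambda>u\<in>U. a) \<in> plots A) \<and>
     \<comment> \<open>locality\<close>
     (\<forall>(n, U, p) \<in> params (points A).
        (\<forall>u\<in>U. \<exists>V\<subseteq>U. openin (Euclidean_space n) V \<and> u \<in> V \<and> (n, V, restrict p V) \<in> plots A)
        \<longrightarrow> (n, U, p) \<in> plots A) \<and>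
     \<comment> \<open>smooth compatibility\<close>
     (\<forall>(n, U, p) \<in> plots A. \<forall>m V f.
        openin (Euclidean_space m) V \<and> smooth_euclid m V n U f
        \<longrightarrow> (m, V, compose V p f) \<in> plots A)"

definition smooth_map :: "'a diffspace \<Rightarrow> 'b diffspace \<Rightarrow> ('a \<Rightarrow> 'b) \<Rightarrow> bool" where
  "smooth_map A B f \<longleftrightarrow>
     f \<in> points A \<rightarrow> points B \<and> (\<forall>(n, U, p) \<in> plots A. (n, U, compose U f p) \<in> plots B)"

definition euclid_diff :: "nat \<Rightarrow> (nat \<Rightarrow> real) set \<Rightarrow> (nat \<Rightarrow> real) diffspace" where
  "euclid_diff n U =
     \<lparr>points = U, plots = {(m, V, f) \<in> params U. smooth_euclid m V n U f}\<rparr>"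

definition subspace_diff :: "'a diffspace \<Rightarrow> 'a set \<Rightarrow> 'a diffspace" where
  "subspace_diff A S = \<lparr>points = S, plots = plots A \<inter> params S\<rparr>"

definition prod_diff :: "'a diffspace \<Rightarrow> 'b diffspace \<Rightarrow> ('a \<times> 'b) diffspace" where
  "prod_diff A B =
     \<lparr>points = points A \<times> points B,
      plots = {(n, U, p) \<in> params (points A \<times> points B).
                 (n, U, compose U fst p) \<in> plots A \<and> (n, U, compose U snd p) \<in> plots B}\<rparr>"

text \<open>The smallest diffeology on \<open>Y\<close> containing the family \<open>F\<close> of parametrizations of \<open>Y\<close>.\<close>

definition generated_diff :: "'a set \<Rightarrow> 'a param set \<Rightarrow> 'a diffspace" where
  "generated_diff Y F =
     \<lparr>points = Y, plots = \<Inter> {D. diffeological_space \<lparr>points = Y, plots = D\<rparr> \<and> F \<subseteq> D}\<rparr>"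

definition pushforward_diff :: "'a diffspace \<Rightarrow> ('a \<Rightarrow> 'b) \<Rightarrow> 'b set \<Rightarrow> 'b diffspace" where
  "pushforward_diff A f Y = generated_diff Y {(n, U, compose U f p) | n U p. (n, U, p) \<in> plots A}"

definition pullback_diff :: "'a set \<Rightarrow> ('a \<Rightarrow> 'b) \<Rightarrow> 'b diffspace \<Rightarrow> 'a diffspace" where
  "pullback_diff S f B =
     \<lparr>points = S, plots = {(n, U, p) \<in> params S. (n, U, compose U f p) \<in> plots B}\<rparr>"

definition D_topology :: "'a diffspace \<Rightarrow> 'a topology" where
  "D_topology A = topology (\<lambda>S. S \<subseteq> points A \<and>
     (\<forall>(n, U, p) \<in> plots A. openin (Euclidean_space n) {u \<in> U. p u \<in> S}))"

lemma openin_D_topology: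
  "openin (D_topology A) S \<longleftrightarrow>
     S \<subseteq> points A \<and> (\<forall>(n, U, p) \<in> plots A. openin (Euclidean_space n) {u \<in> U. p u \<in> S})"
proof -
  have "istopology (\<lambda>S. S \<subseteq> points A \<and>
     (\<forall>(n, U, p) \<in> plots A. openin (Euclidean_space n) {u \<in> U. p u \<in> S}))"
    unfolding istopology_def
  proof (intro conjI allI impI)
    fix S T
    assume S: "S \<subseteq> points A \<and> (\<forall>(n, U, p) \<in> plots A. openin (Euclidean_space n) {u \<in> U. p u \<in> S})"
      and T: "T \<subseteq> points A \<and> (\<forall>(n, U, p) \<in> plots A. openin (Euclidean_space n) {u \<in> U. p u \<in> T})"
    show "S \<inter> T \<subseteq> points A" using S by blast
    have "{u \<in> U. p u \<in> S \<inter> T} = {u \<in> U. p u \<in> S} \<inter> {u \<in> U. p u \<in> T}"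
      for U and p :: "(nat \<Rightarrow> real) \<Rightarrow> 'a" by blast
    then show "\<forall>(n, U, p) \<in> plots A. openin (Euclidean_space n) {u \<in> U. p u \<in> S \<inter> T}"
      using S T by fastforce
  next
    fix \<K>
    assume K: "\<forall>K\<in>\<K>. K \<subseteq> points A \<and>
      (\<forall>(n, U, p) \<in> plots A. openin (Euclidean_space n) {u \<in> U. p u \<in> K})"
    show "\<Union>\<K> \<subseteq> points A" using K by blast
    have "{u \<in> U. p u \<in> \<Union>\<K>} = \<Union> ((\<lambda>K. {u \<in> U. p u \<in> K}) ` \<K>)"
      for U and p :: "(nat \<Rightarrow> real) \<Rightarrow> 'a" by blast
    then show "\<forall>(n, U, p) \<in> plots A. openin (Euclidean_space n) {u \<in> U. p u \<in> \<Union>\<K>}"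
      using K by fastforce
  qed
  then show ?thesis
    by (simp add: D_topology_def topology_inverse')
qed

definition Diff :: "'a diffspace \<Rightarrow> ('a \<Rightarrow> 'a) set" where
  "Diff A = {f \<in> Bij (points A). smooth_map A A f \<and> smooth_map A A (inv_into (points A) f)}"

text \<open>
  The functional diffeology on \<open>Diff A\<close>: both \<open>(u, a) \<mapsto> g\<^sub>u(a)\<close> and \<open>(u, a) \<mapsto> g\<^sub>u\<^sup>-\<^sup>1(a)\<close> are smooth
  on the product of the domain of the plot with \<open>A\<close>.
\<close>

definition Diff_space :: "'a diffspace \<Rightarrow> ('a \<Rightarrow> 'a) diffspace" where
  "Diff_space A =
     \<lparr>points = Diff A,
      plots = {(n, U, g) \<in> params (Diff A).
                 smooth_map (prod_diff (euclid_diff n U) A) A (\<lambda>(u, a). g u a) \<and>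
                 smooth_map (prod_diff (euclid_diff n U) A) A
                   (\<lambda>(u, a). inv_into (points A) (g u) a)}\<rparr>"

text \<open>The diffeology on \<open>X\<close> pushed forward from \<open>G\<close> by an action \<open>act\<close> on \<open>X\<close>.\<close>

definition action_diff :: "'g diffspace \<Rightarrow> ('g \<Rightarrow> 'x \<Rightarrow> 'x) \<Rightarrow> 'x set \<Rightarrow> 'x diffspace" where
  "action_diff G act X =
     generated_diff X {(n, U, \<lambda>u\<in>U. act (g u) x) | n U g x. (n, U, g) \<in> plots G \<and> x \<in> X}"


section \<open>Diffeological fields and vector spaces\<close>

definition diffeological_field :: "('k, 'm) ring_scheme \<Rightarrow> 'k diffspace \<Rightarrow> bool" where
  "diffeological_field K KD \<longleftrightarrow>
     field K \<and> diffeological_space KD \<and> points KD = carrier K \<and>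
     smooth_map (prod_diff KD KD) KD (\<lambda>(a, b). a \<oplus>\<^bsub>K\<^esub> b) \<and>
     smooth_map KD KD (\<lambda>a. \<ominus>\<^bsub>K\<^esub> a) \<and>
     smooth_map (prod_diff KD KD) KD (\<lambda>(a, b). a \<otimes>\<^bsub>K\<^esub> b) \<and>
     smooth_map (subspace_diff KD (carrier K - {\<zero>\<^bsub>K\<^esub>})) KD (\<lambda>a. inv\<^bsub>K\<^esub> a)"

text \<open>Over a field \<open>K\<close>, the library locale \<^locale>\<open>module\<close> is that of \<open>K\<close>-vector spaces.\<close>

definition diffeological_vector_space ::
    "('k, 'm) ring_scheme \<Rightarrow> 'k diffspace \<Rightarrow> ('k, 'v, 'n) module_scheme \<Rightarrow> 'v diffspace \<Rightarrow> bool" where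
  "diffeological_vector_space K KD V VD \<longleftrightarrow>
     module K V \<and> diffeological_space VD \<and> points VD = carrier V \<and>
     smooth_map (prod_diff VD VD) VD (\<lambda>(v, w). v \<oplus>\<^bsub>V\<^esub> w) \<and>
     smooth_map (prod_diff KD VD) VD (\<lambda>(a, v). a \<odot>\<^bsub>V\<^esub> v)"

definition linear_between ::
    "('k, 'm) ring_scheme \<Rightarrow> ('k, 'v, 'n) module_scheme \<Rightarrow> ('k, 'w, 'o) module_scheme
      \<Rightarrow> ('v \<Rightarrow> 'w) \<Rightarrow> bool" where
  "linear_between K V W f \<longleftrightarrow>
     f \<in> carrier V \<rightarrow> carrier W \<and>
     (\<forall>v\<in>carrier V. \<forall>w\<in>carrier V. f (v \<oplus>\<^bsub>V\<^esub> w) = f v \<oplus>\<^bsub>W\<^esub> f w) \<and>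
     (\<forall>a\<in>carrier K. \<forall>v\<in>carrier V. f (a \<odot>\<^bsub>V\<^esub> v) = a \<odot>\<^bsub>W\<^esub> f v)"

definition dvs_isomorphic ::
    "('k, 'm) ring_scheme \<Rightarrow> ('k, 'v, 'n) module_scheme \<Rightarrow> 'v diffspace
      \<Rightarrow> ('k, 'w, 'o) module_scheme \<Rightarrow> 'w diffspace \<Rightarrow> bool" where
  "dvs_isomorphic K V VD W WD \<longleftrightarrow>
     (\<exists>f. linear_between K V W f \<and> bij_betw f (carrier V) (carrier W) \<and>
          smooth_map VD WD f \<and> smooth_map WD VD (inv_into (carrier V) f))"


section \<open>Diffeological vector pseudo-bundles\<close>

record ('k, 'e, 'x) pseudo_bundle =
  total :: "'e diffspace"
  base :: "'x diffspace"
  proj :: "'e \<Rightarrow> 'x"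
  fib_zero :: "'x \<Rightarrow> 'e"
  fib_add :: "'e \<Rightarrow> 'e \<Rightarrow> 'e"
  fib_smult :: "'k \<Rightarrow> 'e \<Rightarrow> 'e"

text \<open>
  The record type of modules extends that of rings; \<^locale>\<open>module\<close> does not use the
  multiplicative fields \<open>mult\<close> and \<open>one\<close> of the module, which are therefore left undefined.
\<close>

definition fiber :: "('k, 'e, 'x) pseudo_bundle \<Rightarrow> 'x \<Rightarrow> ('k, 'e) module" where
  "fiber B x =
     \<lparr>carrier = {e \<in> points (total B). proj B e = x}, mult = undefined, one = undefined,
      zero = fib_zero B x, add = fib_add B, smult = fib_smult B\<rparr>"

definition fiber_space :: "('k, 'e, 'x) pseudo_bundle \<Rightarrow> 'x \<Rightarrow> 'e diffspace" where
  "fiber_space B x = subspace_diff (total B) (carrier (fiber B x))"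

definition fiber_product :: "('k, 'e, 'x) pseudo_bundle \<Rightarrow> ('e \<times> 'e) diffspace" where
  "fiber_product B =
     subspace_diff (prod_diff (total B) (total B))
       {(e, e'). e \<in> points (total B) \<and> e' \<in> points (total B) \<and> proj B e = proj B e'}"

definition vector_pseudo_bundle ::
    "('k, 'm) ring_scheme \<Rightarrow> 'k diffspace \<Rightarrow> ('k, 'e, 'x) pseudo_bundle \<Rightarrow> bool" where
  "vector_pseudo_bundle K KD B \<longleftrightarrow>
     diffeological_space (total B) \<and> diffeological_space (base B) \<and>
     smooth_map (total B) (base B) (proj B) \<and>
     proj B ` points (total B) = points (base B) \<and>
     base B = pushforward_diff (total B) (proj B) (points (base B)) \<and>
     smooth_map (prod_diff KD (total B)) (total B) (\<lambda>(a, e). fib_smult B a e) \<and>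
     smooth_map (fiber_product B) (total B) (\<lambda>(e, e'). fib_add B e e') \<and>
     (\<forall>x\<in>points (base B). diffeological_vector_space K KD (fiber B x) (fiber_space B x))"

definition Aut ::
    "('k, 'm) ring_scheme \<Rightarrow> ('k, 'e, 'x) pseudo_bundle \<Rightarrow> (('e \<Rightarrow> 'e) \<times> ('x \<Rightarrow> 'x)) set" where
  "Aut K B = {(\<phi>, \<psi>). \<phi> \<in> Diff (total B) \<and> \<psi> \<in> Diff (base B) \<and>
     (\<forall>e\<in>points (total B). proj B (\<phi> e) = \<psi> (proj B e)) \<and>
     (\<forall>x\<in>points (base B). linear_between K (fiber B x) (fiber B (\<psi> x)) \<phi>)}"

text \<open>
  Since the projection is surjective, \<open>(\<phi>, \<psi>) \<mapsto> \<phi>\<close> is injective on \<open>Aut K B\<close>; pulling back along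
  it gives \<open>Aut K B\<close> the diffeology of a subgroup of \<open>Diff (total B)\<close>.
\<close>

definition Aut_space ::
    "('k, 'm) ring_scheme \<Rightarrow> ('k, 'e, 'x) pseudo_bundle \<Rightarrow> (('e \<Rightarrow> 'e) \<times> ('x \<Rightarrow> 'x)) diffspace" where
  "Aut_space K B = pullback_diff (Aut K B) fst (Diff_space (total B))"

definition base_group ::
    "('k, 'm) ring_scheme \<Rightarrow> ('k, 'e, 'x) pseudo_bundle \<Rightarrow> ('x \<Rightarrow> 'x) set" where
  "base_group K B = snd ` Aut K B"

text \<open>
  The group of base diffeomorphisms that lift to \<open>Aut K B\<close> carries two diffeologies of a
  diffeological group, that of a subgroup of \<open>Diff (base B)\<close> and that of a quotient of \<open>Aut K B\<close>,
  which may differ in general.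
\<close>

definition base_group_sub ::
    "('k, 'm) ring_scheme \<Rightarrow> ('k, 'e, 'x) pseudo_bundle \<Rightarrow> ('x \<Rightarrow> 'x) diffspace" where
  "base_group_sub K B = subspace_diff (Diff_space (base B)) (base_group K B)"

definition base_group_quot ::
    "('k, 'm) ring_scheme \<Rightarrow> ('k, 'e, 'x) pseudo_bundle \<Rightarrow> ('x \<Rightarrow> 'x) diffspace" where
  "base_group_quot K B = pushforward_diff (Aut_space K B) snd (base_group K B)"

text \<open>
  The pseudo-bundle with the same fibres over the base with the diffeology pushed forward from
  the group \<open>G\<close> of diffeomorphisms of the base.
\<close>

definition Aut_bundle ::
    "('k, 'e, 'x) pseudo_bundle \<Rightarrow> ('x \<Rightarrow> 'x) diffspace \<Rightarrow> ('k, 'e, 'x) pseudo_bundle" where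
  "Aut_bundle B G =
     (let X' = action_diff G (\<lambda>g x. g x) (points (base B)) in
      B\<lparr>total := \<lparr>points = points (total B),
                  plots = plots (total B) \<inter>
                          plots (pullback_diff (points (total B)) (proj B) X')\<rparr>,
        base := X'\<rparr>)"

end

theory Submission
  imports Defs
begin

text \<open>
  In the action diffeology on the base every plot is locally swept out by group elements, so the
  preimage under a plot of a group-invariant set is open. An automorphism \<open>(\<phi>, \<psi>)\<close> restricts to
  an isomorphism from the fibre over \<open>x\<close> to the fibre over \<open>\<psi> x\<close>; hence the set of points whose
  fibre is isomorphic to that over \<open>x\<close> and its complement are both invariant, and their preimages
  separate the total space into two open sets. That the new projection is still a
  subduction needs only that the orbit maps \<open>u \<mapsto> g\<^sub>u(x)\<close> are plots of the original base, which
  holds for both diffeologies on the group: such a plot lifts locally to the total space.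
\<close>

section \<open>Iterated partial derivatives and smooth maps between Euclidean open sets\<close>

lemma C_diff_mono:
  "C_diff k n U f \<Longrightarrow> V \<subseteq> U \<Longrightarrow> C_diff k n V f"
proof (induction k arbitrary: f)
  case 0
  then show ?case by (auto intro: continuous_map_from_subtopology_mono)
next
  case (Suc k)
  have "continuous_map (subtopology (Euclidean_space n) V) euclideanreal f"
    using Suc.prems by (auto intro: continuous_map_from_subtopology_mono)
  moreover have "\<exists>g. C_diff k n V g \<and>
      (\<forall>x\<in>V. ((\<lambda>t. f (x(i := t))) has_real_derivative g x) (at (x i)))" if "i < n" for i
    using Suc that by (simp only: C_diff.simps) (meson subsetD)
  ultimately show ?case by simp
qed

lemma smooth_euclid_mono:
  "smooth_euclid m V n U f \<Longrightarrow> V' \<subseteq> V \<Longrightarrow> f \<in> V' \<rightarrow> U' \<Longrightarrow> smooth_euclid m V' n U' f"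
  unfolding smooth_euclid_def using C_diff_mono by blast

text \<open>The map \<open>t\<close> \<mapsto> \<open>x(i := t)\<close> is continuous into R^n,
  since changing a coordinate below \<open>n\<close> leaves the zero tail intact. The resulting
  neighbourhood of \<open>x i\<close> is where derivatives along a coordinate can be
  compared.\<close>

lemma open_coordinate_line:
  assumes "openin (Euclidean_space n) U" "x \<in> U" "i < n"
  shows "open {t. x(i := t) \<in> U}"
proof -
  have x: "\<And>j. j \<ge> n \<Longrightarrow> x j = 0"
    using assms openin_subset topspace_Euclidean_space by blast
  have "continuous_map euclideanreal (Euclidean_space n) (\<lambda>t. x(i := t))"
    unfolding Euclidean_space_def continuous_map_in_subtopology
    using assms(3) x by (auto simp: continuous_map_componentwise_UNIV)
  then have "openin euclideanreal {t \<in> topspace euclideanreal. x(i := t) \<in> U}"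
    using assms(1) openin_continuous_map_preimage by blast
  then show ?thesis by simp
qed

text \<open>The functions in \<open>C_diff\<close> are differentiated along a whole coordinate line,
  which may leave \<open>U\<close>. Openness of \<open>U\<close> keeps the line inside near
  \<open>x i\<close>, and the derivative at \<open>x i\<close> sees no more than that; the same
  \<open>h\<close> then serves for \<open>g\<close>.\<close>

lemma C_diff_cong:
  "C_diff k n U f \<Longrightarrow> openin (Euclidean_space n) U \<Longrightarrow> (\<And>x. x \<in> U \<Longrightarrow> f x = g x) \<Longrightarrow> C_diff k n U g"
proof (induction k)
  case 0
  then show ?case by (auto elim: continuous_map_eq)
next
  case (Suc k)
  have "continuous_map (subtopology (Euclidean_space n) U) euclideanreal g"
    by (rule continuous_map_eq[of _ _ f]) (use Suc.prems in auto)
  moreover have "\<exists>h. C_diff k n U h \<and>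
      (\<forall>x\<in>U. ((\<lambda>t. g (x(i := t))) has_real_derivative h x) (at (x i)))" if "i < n" for i
  proof -
    obtain h where h: "C_diff k n U h"
      "\<forall>x\<in>U. ((\<lambda>t. f (x(i := t))) has_real_derivative h x) (at (x i))"
      using Suc.prems(1) \<open>i < n\<close> unfolding C_diff.simps by blast
    have "((\<lambda>t. g (x(i := t))) has_real_derivative h x) (at (x i))" if "x \<in> U" for x
    proof (rule has_field_derivative_transform_within_open[where S = "{t. x(i := t) \<in> U}"])
      show "((\<lambda>t. f (x(i := t))) has_real_derivative h x) (at (x i))" using h that by blast
    qed (use that open_coordinate_line[OF Suc.prems(2) that \<open>i < n\<close>] Suc.prems(3) in auto)
    then show ?thesis using h by blast
  qed
  ultimately show ?case by simp
qed

lemma C_diff_const: "C_diff k n U (\<lambda>_. c)"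
  by (induction k arbitrary: c) (auto intro!: exI[of _ "\<lambda>_. 0"])

text \<open>Each partial derivative of a coordinate is the constant 0 or 1, so
  \<open>C_diff_const\<close> covers all higher orders.\<close>

lemma C_diff_coord: "C_diff k n U (\<lambda>x. x i)"
proof -
  have c: "continuous_map (subtopology (Euclidean_space n) U) euclideanreal (\<lambda>x. x i)"
    unfolding Euclidean_space_def
    by (intro continuous_map_from_subtopology continuous_map_product_projection) auto
  show ?thesis
  proof (cases k)
    case 0
    then show ?thesis using c by simp
  next
    case (Suc l)
    have "((\<lambda>t. (x(j := t)) i) has_real_derivative (if i = j then 1 else 0)) (at (x j))"
      for x :: "nat \<Rightarrow> real" and j
      by (cases "i = j") (auto simp: DERIV_ident)
    then have "\<exists>g. C_diff l n U g \<and>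
        (\<forall>x\<in>U. ((\<lambda>t. (x(j := t)) i) has_real_derivative g x) (at (x j)))" for j
      by (intro exI[of _ "\<lambda>_. if i = j then 1 else 0"]) (auto intro: C_diff_const)
    then show ?thesis using c unfolding Suc C_diff.simps by blast
  qed
qed

lemma smooth_euclid_inclusion: "V \<subseteq> U \<Longrightarrow> smooth_euclid n V n U (\<lambda>u. u)"
  by (auto simp: smooth_euclid_def intro: C_diff_coord)

text \<open>Plots are extensional, so the identity of \<open>U\<close> occurs as a plot of
  \<open>euclid_diff n U\<close> in this restricted form.\<close>

lemma smooth_euclid_restrict_id:
  "openin (Euclidean_space n) U \<Longrightarrow> smooth_euclid n U n U (\<lambda>u\<in>U. u)"
  unfolding smooth_euclid_def by (auto intro: C_diff_cong[OF C_diff_coord])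

text \<open>Smoothness makes \<open>f\<close> continuous on \<open>V\<close> as a map into R^n, and
  openness of \<open>V\<close> turns relatively open into open.\<close>

lemma smooth_euclid_open_preimage:
  assumes f: "smooth_euclid m V n U f" and V: "openin (Euclidean_space m) V"
    and U: "openin (Euclidean_space n) U" and W: "openin (Euclidean_space n) W"
  shows "openin (Euclidean_space m) {v \<in> V. f v \<in> W}"
proof -
  let ?V = "subtopology (Euclidean_space m) V"
  have U0: "u i = 0" if "u \<in> U" "i \<ge> n" for u i
    using U that openin_subset topspace_Euclidean_space by blast
  have V': "topspace ?V = V" using openin_subset[OF V] by auto
  have fU: "f v \<in> U" if "v \<in> V" for v using f that by (auto simp: smooth_euclid_def)
  have "continuous_map ?V euclideanreal (\<lambda>v. f v i)" for i
  proof (cases "i < n")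
    case True
    then have "C_diff 0 m V (\<lambda>v. f v i)" using f unfolding smooth_euclid_def by blast
    then show ?thesis by simp
  next
    \<comment> \<open>Smoothness constrains only the coordinates below \<open>n\<close>; the others
      vanish because \<open>f\<close> takes values in \<open>U\<close>, a subset of R^n.\<close>
    case False
    have "continuous_map ?V euclideanreal (\<lambda>_. 0)" by simp
    then show ?thesis
      by (rule continuous_map_eq) (use U0 fU False V' in auto)
  qed
  then have "continuous_map ?V (powertop_real UNIV) f"
    by (simp add: continuous_map_componentwise_UNIV)
  moreover have "f \<in> topspace ?V \<rightarrow> {x. \<forall>i\<ge>n. x i = 0}"
    using U0 fU V' by blast
  ultimately have "continuous_map ?V (Euclidean_space n) f"
    unfolding Euclidean_space_def continuous_map_in_subtopology by blast
  then have "openin ?V {v \<in> topspace ?V. f v \<in> W}"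
    using W openin_continuous_map_preimage by blast
  then show ?thesis unfolding V' openin_open_subtopology[OF V] by blast
qed

section \<open>Axioms of diffeological spaces and smooth maps\<close>

lemma in_params: "(n, U, p) \<in> params A \<longleftrightarrow> openin (Euclidean_space n) U \<and> p \<in> U \<rightarrow>\<^sub>E A"
  by (simp add: params_def)

text \<open>The openness of \<open>U\<close> and the typing of \<open>p\<close> in the last premise
  follow from the first premise and are thus available in every verification of smooth
  compatibility.\<close>

lemma diffeological_spaceI:
  assumes "plots A \<subseteq> params (points A)"
    and "\<And>n U a. openin (Euclidean_space n) U \<Longrightarrow> a \<in> points A \<Longrightarrow> (n, U, \<lambda>u\<in>U. a) \<in> plots A"
    and "\<And>n U p. (n, U, p) \<in> params (points A) \<Longrightarrow>
      (\<And>u. u \<in> U \<Longrightarrow> \<exists>V\<subseteq>U. openin (Euclidean_space n) V \<and> u \<in> V \<and> (n, V, restrict p V) \<in> plots A) \<Longrightarrow>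
      (n, U, p) \<in> plots A"
    and "\<And>n U p m V f. (n, U, p) \<in> plots A \<Longrightarrow> openin (Euclidean_space n) U \<Longrightarrow> p \<in> U \<rightarrow>\<^sub>E points A \<Longrightarrow>
      openin (Euclidean_space m) V \<Longrightarrow> smooth_euclid m V n U f \<Longrightarrow> (m, V, compose V p f) \<in> plots A"
  shows "diffeological_space A"
  unfolding diffeological_space_def
proof (intro conjI)
  show "\<forall>(n, U, p) \<in> plots A. \<forall>m V f.
        openin (Euclidean_space m) V \<and> smooth_euclid m V n U f \<longrightarrow> (m, V, compose V p f) \<in> plots A"
  proof clarify
    fix n U p m V f
    assume a: "(n, U, p) \<in> plots A" "openin (Euclidean_space m) V" "smooth_euclid m V n U f"
    then have "(n, U, p) \<in> params (points A)" using assms(1) by blast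
    then show "(m, V, compose V p f) \<in> plots A" using assms(4) a by (simp add: in_params)
  qed
  show "\<forall>(n, U, p) \<in> params (points A).
      (\<forall>u\<in>U. \<exists>V\<subseteq>U. openin (Euclidean_space n) V \<and> u \<in> V \<and> (n, V, restrict p V) \<in> plots A)
      \<longrightarrow> (n, U, p) \<in> plots A"
    using assms(3) by (simp add: split_paired_all)
  show "\<forall>n U a. openin (Euclidean_space n) U \<and> a \<in> points A \<longrightarrow> (n, U, \<lambda>u\<in>U. a) \<in> plots A"
    by (intro allI impI, elim conjE) (rule assms(2))
qed (rule assms(1))

lemma
  assumes "diffeological_space A"
  shows plot_in_params: "(n, U, p) \<in> plots A \<Longrightarrow> (n, U, p) \<in> params (points A)"
    and plot_const: "openin (Euclidean_space n) U \<Longrightarrow> a \<in> points A \<Longrightarrow> (n, U, \<lambda>u\<in>U. a) \<in> plots A"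
    and plot_local: "(n, U, p) \<in> params (points A) \<Longrightarrow>
      (\<And>u. u \<in> U \<Longrightarrow> \<exists>V\<subseteq>U. openin (Euclidean_space n) V \<and> u \<in> V \<and> (n, V, restrict p V) \<in> plots A) \<Longrightarrow>
      (n, U, p) \<in> plots A"
    and plot_compose: "(n, U, p) \<in> plots A \<Longrightarrow> openin (Euclidean_space m) V \<Longrightarrow>
      smooth_euclid m V n U f \<Longrightarrow> (m, V, compose V p f) \<in> plots A"
proof -
  note A = assms[unfolded diffeological_space_def]
  show "(n, U, p) \<in> plots A \<Longrightarrow> (n, U, p) \<in> params (points A)"
    by (rule subsetD[OF conjunct1[OF A]])
  show "openin (Euclidean_space n) U \<Longrightarrow> a \<in> points A \<Longrightarrow> (n, U, \<lambda>u\<in>U. a) \<in> plots A"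
    using conjunct1[OF conjunct2[OF A]] by blast
  show "(n, U, p) \<in> plots A" if p: "(n, U, p) \<in> params (points A)"
    and loc: "\<And>u. u \<in> U \<Longrightarrow>
      \<exists>V\<subseteq>U. openin (Euclidean_space n) V \<and> u \<in> V \<and> (n, V, restrict p V) \<in> plots A"
    using bspec[OF conjunct1[OF conjunct2[OF conjunct2[OF A]]] p] loc by simp
  show "(m, V, compose V p f) \<in> plots A" if p: "(n, U, p) \<in> plots A"
    and f: "openin (Euclidean_space m) V" "smooth_euclid m V n U f"
    using bspec[OF conjunct2[OF conjunct2[OF conjunct2[OF A]]] p] f by simp
qed

text \<open>Restriction is reparametrization by the inclusion of \<open>V\<close> in
  \<open>U\<close>, which is smooth.\<close>

lemma plot_restrict:
  assumes "diffeological_space A" "(n, U, p) \<in> plots A" "openin (Euclidean_space n) V" "V \<subseteq> U"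
  shows "(n, V, restrict p V) \<in> plots A"
  using plot_compose[OF assms(1-3) smooth_euclid_inclusion[OF assms(4)]]
  by (simp add: compose_def restrict_def)

lemma smooth_mapI:
  assumes "f \<in> points A \<rightarrow> points B"
    and "\<And>n U p. (n, U, p) \<in> plots A \<Longrightarrow> (n, U, compose U f p) \<in> plots B"
  shows "smooth_map A B f"
  using assms by (auto simp: smooth_map_def)

lemma smooth_map_plot:
  "smooth_map A B f \<Longrightarrow> (n, U, p) \<in> plots A \<Longrightarrow> (n, U, compose U f p) \<in> plots B"
  by (auto simp: smooth_map_def)

lemma compose_eqI: "(\<And>u. u \<in> U \<Longrightarrow> g (f u) = g' (f' u)) \<Longrightarrow> compose U g f = compose U g' f'"
  by (auto simp: compose_def restrict_def)

text \<open>Composites with plots see only values on \<open>points A\<close>. This allows an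
  explicit inverse to be exchanged for \<open>inv_into\<close>.\<close>

lemma smooth_map_cong:
  assumes "smooth_map A B f" "plots A \<subseteq> params (points A)" "\<And>a. a \<in> points A \<Longrightarrow> f a = g a"
  shows "smooth_map A B g"
proof (rule smooth_mapI)
  show "g \<in> points A \<rightarrow> points B"
    using assms(1) by (auto simp: smooth_map_def Pi_iff simp flip: assms(3))
  fix n U p assume p: "(n, U, p) \<in> plots A"
  then have "p \<in> U \<rightarrow> points A" using assms(2) by (auto simp: params_def)
  then have "compose U g p = compose U f p" by (intro compose_eqI) (auto simp: assms(3) Pi_iff)
  then show "(n, U, compose U g p) \<in> plots B" using smooth_map_plot[OF assms(1) p] by simp
qed

lemma smooth_map_comp:
  assumes "smooth_map A B f" "smooth_map B C g"
  shows "smooth_map A C (g \<circ> f)"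
proof (rule smooth_mapI)
  show "g \<circ> f \<in> points A \<rightarrow> points C" using assms by (auto simp: smooth_map_def)
  fix n U p assume "(n, U, p) \<in> plots A"
  then have "(n, U, compose U g (compose U f p)) \<in> plots C"
    by (intro smooth_map_plot[OF assms(2)] smooth_map_plot[OF assms(1)])
  moreover have "compose U g (compose U f p) = compose U (g \<circ> f) p"
    by (auto simp: compose_def restrict_def)
  ultimately show "(n, U, compose U (g \<circ> f) p) \<in> plots C" by simp
qed

section \<open>Generated diffeologies, pullbacks and intersections\<close>

text \<open>This is the coarsest diffeology on \<open>Y\<close>; it ensures that the intersection
  defining \<open>generated_diff\<close> runs over a nonempty family.\<close>

lemma diffeological_space_params:
  "diffeological_space \<lparr>points = Y, plots = params Y\<rparr>"
  by (rule diffeological_spaceI)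
    (auto simp: in_params smooth_euclid_def compose_def PiE_iff Pi_iff split: if_splits)

text \<open>The covering, locality and compatibility axioms pass to intersections member by member.
  That plots are parametrizations of \<open>Y\<close> comes from the single member
  \<open>params Y\<close>, which the assumption on \<open>F\<close> places in the family.\<close>

lemma diffeological_space_generated:
  assumes "F \<subseteq> params Y"
  shows "diffeological_space (generated_diff Y F)"
proof -
  let ?\<D> = "{D. diffeological_space \<lparr>points = Y, plots = D\<rparr> \<and> F \<subseteq> D}"
  have mem: "x \<in> plots (generated_diff Y F) \<longleftrightarrow> (\<forall>D\<in>?\<D>. x \<in> D)" for x
    by (simp add: generated_diff_def)
  have pts: "points (generated_diff Y F) = Y" by (simp add: generated_diff_def)
  have P: "params Y \<in> ?\<D>" using diffeological_space_params assms by blast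
  show ?thesis
  proof (rule diffeological_spaceI)
    show "plots (generated_diff Y F) \<subseteq> params (points (generated_diff Y F))"
      unfolding pts using bspec[OF iffD1[OF mem] P] by blast
  next
    fix n U a assume "openin (Euclidean_space n) U" "a \<in> points (generated_diff Y F)"
    then show "(n, U, \<lambda>u\<in>U. a) \<in> plots (generated_diff Y F)"
      unfolding mem pts
      using plot_const[of "\<lparr>points = Y, plots = D\<rparr>" n U a for D] by simp
  next
    fix n U and p :: "(nat \<Rightarrow> real) \<Rightarrow> 'a"
    assume p: "(n, U, p) \<in> params (points (generated_diff Y F))"
      and loc: "\<And>u. u \<in> U \<Longrightarrow> \<exists>V\<subseteq>U. openin (Euclidean_space n) V \<and> u \<in> V \<and>
        (n, V, restrict p V) \<in> plots (generated_diff Y F)"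
    show "(n, U, p) \<in> plots (generated_diff Y F)"
      unfolding mem
    proof
      fix D assume D: "D \<in> ?\<D>"
      have "\<exists>V\<subseteq>U. openin (Euclidean_space n) V \<and> u \<in> V \<and> (n, V, restrict p V) \<in> D"
        if "u \<in> U" for u
      proof -
        obtain V where V: "V \<subseteq> U" "openin (Euclidean_space n) V" "u \<in> V"
          "(n, V, restrict p V) \<in> plots (generated_diff Y F)"
          using loc[OF \<open>u \<in> U\<close>] by blast
        moreover have "(n, V, restrict p V) \<in> D" using V(4) D unfolding mem by (rule bspec)
        ultimately show ?thesis by blast
      qed
      then show "(n, U, p) \<in> D"
        using plot_local[of "\<lparr>points = Y, plots = D\<rparr>" n U p] D p pts by simp
    qed
  next
    fix n U p m V f
    assume "(n, U, p) \<in> plots (generated_diff Y F)"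
      "openin (Euclidean_space m) V" "smooth_euclid m V n U f"
    then show "(m, V, compose V p f) \<in> plots (generated_diff Y F)"
      unfolding mem
      using plot_compose[of "\<lparr>points = Y, plots = D\<rparr>" n U p m V f for D] by simp
  qed
qed

lemma points_generated_diff [simp]: "points (generated_diff Y F) = Y"
  by (simp add: generated_diff_def)

lemma generated_diff_superset: "F \<subseteq> plots (generated_diff Y F)"
  by (auto simp: generated_diff_def)

text \<open>Minimality, used as an induction principle: for a property of generated plots it
  suffices that the parametrizations having it form a diffeology which contains the
  generators.\<close>

lemma plots_generated_diff_subset:
  "diffeological_space A \<Longrightarrow> points A = Y \<Longrightarrow> F \<subseteq> plots A \<Longrightarrow> plots (generated_diff Y F) \<subseteq> plots A"
  by (cases A) (auto simp: generated_diff_def)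

text \<open>Composition with \<open>f\<close> commutes with restriction and with reparametrization,
  so the axioms are inherited from \<open>B\<close>.\<close>

lemma diffeological_space_pullback:
  assumes "diffeological_space B" "f \<in> S \<rightarrow> points B"
  shows "diffeological_space (pullback_diff S f B)"
proof (rule diffeological_spaceI)
  fix n U and a assume "openin (Euclidean_space n) U" "a \<in> points (pullback_diff S f B)"
  then show "(n, U, \<lambda>u\<in>U. a) \<in> plots (pullback_diff S f B)"
    using plot_const[OF assms(1), of n U "f a"] assms(2)
    by (auto simp: pullback_diff_def in_params compose_def restrict_def cong: if_cong)
next
  fix n U p
  assume p: "(n, U, p) \<in> params (points (pullback_diff S f B))"
    and loc: "\<And>u. u \<in> U \<Longrightarrow> \<exists>V\<subseteq>U. openin (Euclidean_space n) V \<and> u \<in> V \<and>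
        (n, V, restrict p V) \<in> plots (pullback_diff S f B)"
  have "(n, U, compose U f p) \<in> plots B"
  proof (rule plot_local[OF assms(1)])
    show "(n, U, compose U f p) \<in> params (points B)"
      using p assms(2) by (auto simp: pullback_diff_def in_params compose_def PiE_iff Pi_iff)
    fix u assume "u \<in> U"
    then obtain V where V: "V \<subseteq> U" "openin (Euclidean_space n) V" "u \<in> V"
      "(n, V, compose V f (restrict p V)) \<in> plots B"
      using loc by (auto simp: pullback_diff_def)
    moreover have "compose V f (restrict p V) = restrict (compose U f p) V"
      using V(1) by (auto simp: compose_def restrict_def subset_iff)
    ultimately show "\<exists>V\<subseteq>U. openin (Euclidean_space n) V \<and> u \<in> V \<and>
        (n, V, restrict (compose U f p) V) \<in> plots B"
      by auto
  qed
  then show "(n, U, p) \<in> plots (pullback_diff S f B)"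
    using p by (simp add: pullback_diff_def)
next
  fix n U p m V h
  assume p: "(n, U, p) \<in> plots (pullback_diff S f B)" and V: "openin (Euclidean_space m) V"
    and h: "smooth_euclid m V n U h"
  have hU: "h \<in> V \<rightarrow> U" using h by (simp add: smooth_euclid_def)
  have "(m, V, compose V (compose U f p) h) \<in> plots B"
    using p by (intro plot_compose[OF assms(1) _ V h]) (simp add: pullback_diff_def)
  moreover have "compose V (compose U f p) h = compose V f (compose V p h)"
    using hU by (intro ext) (auto simp: compose_def restrict_def Pi_iff)
  ultimately show "(m, V, compose V p h) \<in> plots (pullback_diff S f B)"
    using p V hU by (auto simp: pullback_diff_def in_params compose_def PiE_iff Pi_iff)
qed (auto simp: pullback_diff_def)

text \<open>This serves for the total space of \<open>Aut_bundle\<close>, whose plots are the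
  intersection of the original diffeology with a pullback.\<close>

lemma diffeological_space_Int:
  assumes A: "diffeological_space A" and B: "diffeological_space B" and "points B = points A"
  shows "diffeological_space \<lparr>points = points A, plots = plots A \<inter> plots B\<rparr>"
proof (rule diffeological_spaceI, simp_all only: diffspace.simps)
  show "plots A \<inter> plots B \<subseteq> params (points A)"
    using plot_in_params[OF A] by auto
next
  fix n U a assume "openin (Euclidean_space n) U" "a \<in> points A"
  then show "(n, U, \<lambda>u\<in>U. a) \<in> plots A \<inter> plots B"
    using plot_const[OF A] plot_const[OF B] assms(3) by blast
next
  fix n U p assume p: "(n, U, p) \<in> params (points A)"
    and loc: "\<And>u. u \<in> U \<Longrightarrow> \<exists>V\<subseteq>U. openin (Euclidean_space n) V \<and> u \<in> V \<and>
      (n, V, restrict p V) \<in> plots A \<inter> plots B"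
  have "(n, U, p) \<in> plots A"
    by (rule plot_local[OF A p]) (use loc in blast)
  moreover have "(n, U, p) \<in> plots B"
    by (rule plot_local[OF B p[folded assms(3)]]) (use loc in blast)
  ultimately show "(n, U, p) \<in> plots A \<inter> plots B" by blast
next
  fix n U p m V f
  assume p: "(n, U, p) \<in> plots A \<inter> plots B"
    and f: "openin (Euclidean_space m) V" "smooth_euclid m V n U f"
  show "(m, V, compose V p f) \<in> plots A \<inter> plots B"
    using p plot_compose[OF A _ f] plot_compose[OF B _ f] by blast
qed

section \<open>Push-forwards, orbit maps and invariant sets\<close>

text \<open>The locally constant alternative in the usual description of a push-forward is absorbed
  by surjectivity.\<close>

lemma pushforward_plot_local_lift:
  assumes A: "diffeological_space A" and surj: "f ` points A = Y"
    and p: "(n, U, p) \<in> plots (pushforward_diff A f Y)" and u: "u \<in> U"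
  shows "\<exists>V q. V \<subseteq> U \<and> openin (Euclidean_space n) V \<and> u \<in> V \<and> (n, V, q) \<in> plots A \<and>
    restrict p V = compose V f q"
proof -
  \<comment> \<open>These are the locally liftable parametrizations. Once they are seen to form a
    diffeology containing the generators, minimality of the push-forward finishes the proof.\<close>
  define D where "D = \<lparr>points = Y, plots = {(n, U, p) \<in> params Y. \<forall>u\<in>U. \<exists>V q. V \<subseteq> U \<and>
    openin (Euclidean_space n) V \<and> u \<in> V \<and> (n, V, q) \<in> plots A \<and> restrict p V = compose V f q}\<rparr>"
  have "diffeological_space D"
  proof (rule diffeological_spaceI)
    fix n U a assume U: "openin (Euclidean_space n) U" "a \<in> points D"
    then obtain b where b: "b \<in> points A" "f b = a" using surj by (auto simp: D_def)
    have "(n, U, \<lambda>u\<in>U. b) \<in> plots A" using plot_const[OF A] U b by blast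
    then show "(n, U, \<lambda>u\<in>U. a) \<in> plots D"
      unfolding D_def using U b
      by (auto simp: in_params D_def compose_def restrict_def cong: if_cong
          intro!: exI[of _ U] exI[of _ "\<lambda>u\<in>U. b"])
  next
    fix n U p assume p: "(n, U, p) \<in> params (points D)"
      and loc: "\<And>u. u \<in> U \<Longrightarrow> \<exists>V\<subseteq>U. openin (Euclidean_space n) V \<and> u \<in> V \<and>
        (n, V, restrict p V) \<in> plots D"
    have "\<exists>V q. V \<subseteq> U \<and> openin (Euclidean_space n) V \<and> u \<in> V \<and> (n, V, q) \<in> plots A \<and>
        restrict p V = compose V f q" if u: "u \<in> U" for u
    proof -
      obtain V where V: "V \<subseteq> U" "u \<in> V" "(n, V, restrict p V) \<in> plots D" using loc[OF u] by blast
      then obtain W q where W: "W \<subseteq> V" "openin (Euclidean_space n) W" "u \<in> W" "(n, W, q) \<in> plots A"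
        "restrict (restrict p V) W = compose W f q"
        by (auto simp: D_def)
      have "restrict (restrict p V) W = restrict p W"
        using W(1) by (simp add: restrict_restrict Int_absorb1)
      then show ?thesis using V W by (metis order_trans)
    qed
    then show "(n, U, p) \<in> plots D" using p by (simp add: D_def)
  next
    fix n U p m V h
    assume p: "(n, U, p) \<in> plots D" and U: "openin (Euclidean_space n) U"
      and V: "openin (Euclidean_space m) V" and h: "smooth_euclid m V n U h"
    have hU: "h \<in> V \<rightarrow> U" using h by (simp add: smooth_euclid_def)
    have "\<exists>V' q. V' \<subseteq> V \<and> openin (Euclidean_space m) V' \<and> v \<in> V' \<and> (m, V', q) \<in> plots A \<and>
        restrict (compose V p h) V' = compose V' f q" if v: "v \<in> V" for v
    proof -
      obtain W q where W: "W \<subseteq> U" "openin (Euclidean_space n) W" "h v \<in> W" "(n, W, q) \<in> plots A"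
        "restrict p W = compose W f q"
        using p hU v unfolding D_def by (auto dest!: bspec[where x = "h v"])
      \<comment> \<open>A lift \<open>q\<close> of \<open>p\<close> near \<open>h v\<close> yields
        the lift \<open>q \<circ> h\<close> near \<open>v\<close>, on the preimage of the domain of
        \<open>q\<close>.\<close>
      let ?V = "{v \<in> V. h v \<in> W}"
      have V': "openin (Euclidean_space m) ?V"
        by (rule smooth_euclid_open_preimage[OF h V U W(2)])
      have "(m, ?V, compose ?V q h) \<in> plots A"
        by (rule plot_compose[OF A W(4) V' smooth_euclid_mono[OF h]]) auto
      moreover have "p w = f (q w)" if "w \<in> W" for w
        using W(5) that by (metis compose_eq restrict_apply')
      then have "restrict (compose V p h) ?V = compose ?V f (compose ?V q h)"
        by (auto simp: compose_def restrict_def)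
      ultimately show ?thesis using V' v W(3)
        by (intro exI[of _ ?V] exI[of _ "compose ?V q h"]) auto
    qed
    moreover have "(m, V, compose V p h) \<in> params Y"
      using p V hU by (auto simp: D_def in_params compose_def PiE_iff Pi_iff)
    ultimately show "(m, V, compose V p h) \<in> plots D" by (simp add: D_def)
  qed (auto simp: D_def)
  moreover have "{(n, U, compose U f p) | n U p. (n, U, p) \<in> plots A} \<subseteq> plots D"
  proof clarify
    fix n U p assume p: "(n, U, p) \<in> plots A"
    have "(n, U, p) \<in> params (points A)" using plot_in_params[OF A p] .
    then have "(n, U, compose U f p) \<in> params Y" "openin (Euclidean_space n) U"
      using surj by (auto simp: in_params compose_def PiE_iff)
    then show "(n, U, compose U f p) \<in> plots D"
      using p by (auto simp: D_def compose_def intro!: exI[of _ U] exI[of _ p])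
  qed
  ultimately have "plots (pushforward_diff A f Y) \<subseteq> plots D"
    unfolding pushforward_diff_def by (intro plots_generated_diff_subset) (auto simp: D_def)
  then have "(n, U, p) \<in> plots D" using p by blast
  then show ?thesis using u by (simp add: D_def)
qed

text \<open>Evaluation is smooth on the product by definition of the functional diffeology, and
  \<open>u\<close> \<mapsto> \<open>(u, a)\<close> is a plot of that product: the identity in the
  first factor, a constant in the second.\<close>

lemma Diff_space_eval_plot:
  assumes A: "diffeological_space A" and g: "(n, U, g) \<in> plots (Diff_space A)" and a: "a \<in> points A"
  shows "(n, U, \<lambda>u\<in>U. g u a) \<in> plots A"
proof -
  have U: "openin (Euclidean_space n) U"
    and sm: "smooth_map (prod_diff (euclid_diff n U) A) A (\<lambda>(u, a). g u a)"
    using g by (auto simp: Diff_space_def in_params)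
  have c: "compose U fst (\<lambda>u\<in>U. (u, a)) = (\<lambda>u\<in>U. u)" "compose U snd (\<lambda>u\<in>U. (u, a)) = (\<lambda>u\<in>U. a)"
    by (auto simp: compose_def restrict_def)
  have "(n, U, \<lambda>u\<in>U. (u, a)) \<in> plots (prod_diff (euclid_diff n U) A)"
    using U a smooth_euclid_restrict_id[OF U] plot_const[OF A U a]
    by (simp add: prod_diff_def euclid_diff_def c in_params)
  from smooth_map_plot[OF sm this] show ?thesis
    by (simp add: compose_def restrict_def cong: if_cong)
qed

text \<open>Along a generator \<open>u\<close> \<mapsto> \<open>act (g u) x\<close>, membership in
  an invariant set depends on \<open>x\<close> alone, so the preimage of \<open>S\<close> is the
  whole domain or empty. Minimality extends openness to all plots.\<close>

lemma action_diff_open_invariant: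
  assumes G: "plots G \<subseteq> params (points G)" and act: "\<And>g x. g \<in> points G \<Longrightarrow> x \<in> X \<Longrightarrow> act g x \<in> X"
    and inv: "\<And>g x. g \<in> points G \<Longrightarrow> x \<in> X \<Longrightarrow> act g x \<in> S \<longleftrightarrow> x \<in> S"
    and p: "(n, U, p) \<in> plots (action_diff G act X)"
  shows "openin (Euclidean_space n) {u \<in> U. p u \<in> S}"
proof -
  \<comment> \<open>The parametrizations with open preimage of \<open>S\<close> form a diffeology
    because openness is local and survives preimages under smooth maps.\<close>
  define D where "D = \<lparr>points = X, plots = {(n, U, p) \<in> params X.
    openin (Euclidean_space n) {u \<in> U. p u \<in> S}}\<rparr>"
  have "diffeological_space D"
  proof (rule diffeological_spaceI)
    fix n U a assume "openin (Euclidean_space n) U" "a \<in> points D"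
    then show "(n, U, \<lambda>u\<in>U. a) \<in> plots D"
    proof -
      assume U: "openin (Euclidean_space n) U" and a: "a \<in> points D"
      have "{u \<in> U. (\<lambda>u\<in>U. a) u \<in> S} = (if a \<in> S then U else {})" by auto
      then have "openin (Euclidean_space n) {u \<in> U. (\<lambda>u\<in>U. a) u \<in> S}" using U by simp
      then show ?thesis using U a by (simp add: D_def in_params)
    qed
  next
    fix n U p assume p: "(n, U, p) \<in> params (points D)"
      and loc: "\<And>u. u \<in> U \<Longrightarrow> \<exists>V\<subseteq>U. openin (Euclidean_space n) V \<and> u \<in> V \<and>
        (n, V, restrict p V) \<in> plots D"
    have "openin (Euclidean_space n) {u \<in> U. p u \<in> S}"
    proof (subst openin_subopen, clarify)
      fix u assume u: "u \<in> U" "p u \<in> S"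
      then obtain V where V: "V \<subseteq> U" "u \<in> V" "(n, V, restrict p V) \<in> plots D" using loc by blast
      have "{v \<in> V. restrict p V v \<in> S} = {v \<in> V. p v \<in> S}" by auto
      then have "openin (Euclidean_space n) {v \<in> V. p v \<in> S}"
        using V(3) by (simp add: D_def)
      then show "\<exists>T. openin (Euclidean_space n) T \<and> u \<in> T \<and> T \<subseteq> {u \<in> U. p u \<in> S}"
        using u V by (intro exI[of _ "{v \<in> V. p v \<in> S}"]) auto
    qed
    then show "(n, U, p) \<in> plots D" using p by (simp add: D_def)
  next
    fix n U p m V h
    assume p: "(n, U, p) \<in> plots D" and U: "openin (Euclidean_space n) U"
      and V: "openin (Euclidean_space m) V" and h: "smooth_euclid m V n U h"
    have hU: "h \<in> V \<rightarrow> U" using h by (simp add: smooth_euclid_def)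
    have "openin (Euclidean_space m) {v \<in> V. h v \<in> {u \<in> U. p u \<in> S}}"
      using p by (intro smooth_euclid_open_preimage[OF h V U]) (simp add: D_def)
    moreover have "{v \<in> V. h v \<in> {u \<in> U. p u \<in> S}} = {v \<in> V. compose V p h v \<in> S}"
      using hU by (auto simp: compose_def)
    ultimately show "(m, V, compose V p h) \<in> plots D"
      using p V hU by (auto simp: D_def in_params compose_def PiE_iff Pi_iff)
  qed (auto simp: D_def)
  moreover have "{(n, U, \<lambda>u\<in>U. act (g u) x) | n U g x. (n, U, g) \<in> plots G \<and> x \<in> X} \<subseteq> plots D"
  proof clarify
    fix n U g x assume g: "(n, U, g) \<in> plots G" and x: "x \<in> X"
    have U: "openin (Euclidean_space n) U" and gG: "\<And>u. u \<in> U \<Longrightarrow> g u \<in> points G"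
      using G g by (auto simp: params_def PiE_iff)
    have "{u \<in> U. (\<lambda>u\<in>U. act (g u) x) u \<in> S} = (if x \<in> S then U else {})"
      using inv[OF gG x] by auto
    then show "(n, U, \<lambda>u\<in>U. act (g u) x) \<in> plots D"
      using U act gG x by (simp add: D_def in_params)
  qed
  ultimately have "plots (action_diff G act X) \<subseteq> plots D"
    unfolding action_diff_def by (intro plots_generated_diff_subset) (auto simp: D_def)
  then show ?thesis using p by (auto simp: D_def)
qed

section \<open>Isomorphisms of diffeological vector spaces\<close>

text \<open>An arbitrary two-sided inverse \<open>g\<close> replaces \<open>inv_into\<close>, so
  that swapping and composing pairs of maps gives symmetry and transitivity. The hypotheses on
  \<open>WD\<close> let \<open>smooth_map_cong\<close> pass from \<open>g\<close> to
  \<open>inv_into\<close>.\<close>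

lemma dvs_isomorphic_iff:
  assumes "plots WD \<subseteq> params (points WD)" "points WD = carrier W"
  shows "dvs_isomorphic K V VD W WD \<longleftrightarrow>
    (\<exists>f g. linear_between K V W f \<and> g \<in> carrier W \<rightarrow> carrier V \<and>
      (\<forall>v\<in>carrier V. g (f v) = v) \<and> (\<forall>w\<in>carrier W. f (g w) = w) \<and>
      smooth_map VD WD f \<and> smooth_map WD VD g)" (is "?L \<longleftrightarrow> ?R")
proof
  assume ?L
  then obtain f where f: "linear_between K V W f" "bij_betw f (carrier V) (carrier W)"
    "smooth_map VD WD f" "smooth_map WD VD (inv_into (carrier V) f)"
    by (auto simp: dvs_isomorphic_def)
  show ?R
    by (intro exI[of _ f] exI[of _ "inv_into (carrier V) f"])
      (use f bij_betw_inv_into_left[OF f(2)] bij_betw_inv_into_right[OF f(2)]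
        bij_betwE[OF bij_betw_inv_into[OF f(2)]] in auto)
next
  assume ?R
  then obtain f g where f: "linear_between K V W f" "g \<in> carrier W \<rightarrow> carrier V"
    "\<forall>v\<in>carrier V. g (f v) = v" "\<forall>w\<in>carrier W. f (g w) = w"
    "smooth_map VD WD f" "smooth_map WD VD g" by blast
  have bij: "bij_betw f (carrier V) (carrier W)"
    by (rule bij_betw_byWitness[where f' = g]) (use f in \<open>auto simp: linear_between_def\<close>)
  have "smooth_map WD VD (inv_into (carrier V) f)"
  proof (rule smooth_map_cong[OF f(6) assms(1)])
    fix w assume "w \<in> points WD"
    then have w: "w \<in> carrier W" using assms(2) by simp
    have "inv_into (carrier V) f (f (g w)) = g w"
      using bij w f(2) by (intro inv_into_f_f) (auto simp: bij_betw_def)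
    then show "g w = inv_into (carrier V) f w" using f(4) w by simp
  qed
  then show ?L using f bij by (auto simp: dvs_isomorphic_def)
qed

lemma
  assumes "diffeological_vector_space K KD V VD"
  shows dvs_module: "module K V" and dvs_points: "points VD = carrier V"
    and dvs_plots: "plots VD \<subseteq> params (points VD)" and dvs_space: "diffeological_space VD"
  using assms by (auto simp: diffeological_vector_space_def diffeological_space_def)

lemma dvs_isomorphic_refl:
  assumes V: "diffeological_vector_space K KD V VD"
  shows "dvs_isomorphic K V VD V VD"
proof -
  have "smooth_map VD VD (\<lambda>v. v)"
  proof (rule smooth_mapI)
    fix n U p assume p: "(n, U, p) \<in> plots VD"
    \<comment> \<open>Composition with the identity restores \<open>p\<close> exactly because plots
      are extensional.\<close>
    then have "compose U (\<lambda>v. v) p = p"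
      using plot_in_params[OF dvs_space[OF V] p]
      by (simp add: in_params compose_def PiE_iff extensional_restrict)
    then show "(n, U, compose U (\<lambda>v. v) p) \<in> plots VD" using p by simp
  qed auto
  then show ?thesis
    unfolding dvs_isomorphic_iff[OF dvs_plots[OF V] dvs_points[OF V]]
    by (intro exI[of _ "\<lambda>v. v"]) (auto simp: linear_between_def)
qed

text \<open>The inverse is linear: elements of \<open>W\<close> are images under \<open>f\<close>,
  and linearity of \<open>f\<close> is applied inside \<open>g\<close>. Closure of \<open>V\<close>
  under its operations is needed before \<open>g\<close> can cancel \<open>f\<close>.\<close>

lemma dvs_isomorphic_sym:
  assumes V: "diffeological_vector_space K KD V VD" and W: "diffeological_vector_space K KD W WD"
    and iso: "dvs_isomorphic K V VD W WD"
  shows "dvs_isomorphic K W WD V VD"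
proof -
  obtain f g where f: "linear_between K V W f" "g \<in> carrier W \<rightarrow> carrier V"
    "\<forall>v\<in>carrier V. g (f v) = v" "\<forall>w\<in>carrier W. f (g w) = w"
    "smooth_map VD WD f" "smooth_map WD VD g"
    using iso unfolding dvs_isomorphic_iff[OF dvs_plots[OF W] dvs_points[OF W]] by blast
  interpret V: module K V by (rule dvs_module[OF V])
  have gc: "g w \<in> carrier V" if "w \<in> carrier W" for w using f(2) that by blast
  have "g (w \<oplus>\<^bsub>W\<^esub> w') = g w \<oplus>\<^bsub>V\<^esub> g w'" if "w \<in> carrier W" "w' \<in> carrier W" for w w'
    using f(1,3,4) gc[OF that(1)] gc[OF that(2)] that V.add.m_closed
    unfolding linear_between_def by metis
  moreover have "g (a \<odot>\<^bsub>W\<^esub> w) = a \<odot>\<^bsub>V\<^esub> g w" if "a \<in> carrier K" "w \<in> carrier W" for a w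
    using f(1,3,4) gc[OF that(2)] that V.smult_closed
    unfolding linear_between_def by metis
  ultimately have "linear_between K W V g" using f(2) by (simp add: linear_between_def)
  then show ?thesis
    unfolding dvs_isomorphic_iff[OF dvs_plots[OF V] dvs_points[OF V]]
    using f by (intro exI[of _ g] exI[of _ f]) (auto simp: linear_between_def)
qed

lemma dvs_isomorphic_trans:
  assumes V: "diffeological_vector_space K KD V VD" and W: "diffeological_vector_space K KD W WD"
    and Z: "diffeological_vector_space K KD Z ZD"
    and "dvs_isomorphic K V VD W WD" "dvs_isomorphic K W WD Z ZD"
  shows "dvs_isomorphic K V VD Z ZD"
proof -
  obtain f g where f: "linear_between K V W f" "g \<in> carrier W \<rightarrow> carrier V"
    "\<forall>v\<in>carrier V. g (f v) = v" "\<forall>w\<in>carrier W. f (g w) = w"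
    "smooth_map VD WD f" "smooth_map WD VD g"
    using assms(4) unfolding dvs_isomorphic_iff[OF dvs_plots[OF W] dvs_points[OF W]] by blast
  obtain h k where h: "linear_between K W Z h" "k \<in> carrier Z \<rightarrow> carrier W"
    "\<forall>v\<in>carrier W. k (h v) = v" "\<forall>w\<in>carrier Z. h (k w) = w"
    "smooth_map WD ZD h" "smooth_map ZD WD k"
    using assms(5) unfolding dvs_isomorphic_iff[OF dvs_plots[OF Z] dvs_points[OF Z]] by blast
  have fc: "f v \<in> carrier W" if "v \<in> carrier V" for v
    using f(1) that by (auto simp: linear_between_def)
  have "linear_between K V Z (h \<circ> f)"
    using f(1) h(1) fc by (auto simp: linear_between_def)
  moreover have kc: "k z \<in> carrier W" if "z \<in> carrier Z" for z using h(2) that by blast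
  ultimately show ?thesis
    unfolding dvs_isomorphic_iff[OF dvs_plots[OF Z] dvs_points[OF Z]]
    using f h fc smooth_map_comp[OF f(5) h(5)] smooth_map_comp[OF h(6) f(6)]
    by (intro exI[of _ "h \<circ> f"] exI[of _ "g \<circ> k"]) auto
qed

section \<open>Restriction to subspaces and the action diffeology\<close>

lemma smooth_map_subspace:
  assumes f: "smooth_map A B f" and S: "f \<in> S \<rightarrow> T"
  shows "smooth_map (subspace_diff A S) (subspace_diff B T) f"
proof (rule smooth_mapI)
  fix n U p assume "(n, U, p) \<in> plots (subspace_diff A S)"
  then have p: "(n, U, p) \<in> plots A" "(n, U, p) \<in> params S" by (auto simp: subspace_diff_def)
  have "(n, U, compose U f p) \<in> params T"
    using p(2) S by (auto simp: in_params compose_def PiE_iff Pi_iff)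
  then show "(n, U, compose U f p) \<in> plots (subspace_diff B T)"
    using smooth_map_plot[OF f p(1)] by (simp add: subspace_diff_def)
qed (use S in \<open>simp add: subspace_diff_def\<close>)

lemma points_action_diff [simp]: "points (action_diff G act X) = X"
  by (simp add: action_diff_def)

lemma diffeological_space_action_diff:
  assumes "plots G \<subseteq> params (points G)" "\<And>g x. g \<in> points G \<Longrightarrow> x \<in> X \<Longrightarrow> act g x \<in> X"
  shows "diffeological_space (action_diff G act X)"
  unfolding action_diff_def
proof (rule diffeological_space_generated, clarify)
  fix n U g x assume "(n, U, g) \<in> plots G" "x \<in> X"
  moreover have "(n, U, g) \<in> params (points G)" using assms(1) calculation(1) by blast
  ultimately show "(n, U, \<lambda>u\<in>U. act (g u) x) \<in> params X"
    using assms(2) by (auto simp: in_params PiE_iff)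
qed

text \<open>Once the orbit maps are plots of \<open>A\<close>, so are all generators. This yields
  the comparison of the action diffeology with that of the original base.\<close>

lemma plots_action_diff_subset:
  assumes "diffeological_space A"
    and "\<And>n U g x. (n, U, g) \<in> plots G \<Longrightarrow> x \<in> points A \<Longrightarrow> (n, U, \<lambda>u\<in>U. act (g u) x) \<in> plots A"
  shows "plots (action_diff G act (points A)) \<subseteq> plots A"
  unfolding action_diff_def
  using assms by (intro plots_generated_diff_subset) auto

section \<open>Automorphisms and the fibres they relate\<close>

lemmas vector_pseudo_bundleD = vector_pseudo_bundle_def[THEN iffD1]
lemmas vpb_total = vector_pseudo_bundleD[THEN conjunct1]
  and vpb_base = vector_pseudo_bundleD[THEN conjunct2, THEN conjunct1]
  and vpb_proj = vector_pseudo_bundleD[THEN conjunct2, THEN conjunct2, THEN conjunct1]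
  and vpb_surj = vector_pseudo_bundleD[THEN conjunct2, THEN conjunct2, THEN conjunct2, THEN conjunct1]
  and vpb_subduction = vector_pseudo_bundleD[THEN conjunct2, THEN conjunct2, THEN conjunct2, THEN conjunct2, THEN conjunct1]
  and vpb_smult = vector_pseudo_bundleD[THEN conjunct2, THEN conjunct2, THEN conjunct2, THEN conjunct2, THEN conjunct2, THEN conjunct1]
  and vpb_add = vector_pseudo_bundleD[THEN conjunct2, THEN conjunct2, THEN conjunct2, THEN conjunct2, THEN conjunct2, THEN conjunct2, THEN conjunct1]
  and vpb_fiber = vector_pseudo_bundleD[THEN conjunct2, THEN conjunct2, THEN conjunct2, THEN conjunct2, THEN conjunct2, THEN conjunct2, THEN conjunct2, THEN bspec]

lemma carrier_fiber: "e \<in> carrier (fiber B x) \<longleftrightarrow> e \<in> points (total B) \<and> proj B e = x"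
  by (simp add: fiber_def)

lemma
  assumes "(\<phi>, \<psi>) \<in> Aut K B"
  shows Aut_total: "\<phi> \<in> Diff (total B)" and Aut_base: "\<psi> \<in> Diff (base B)"
    and Aut_proj: "e \<in> points (total B) \<Longrightarrow> proj B (\<phi> e) = \<psi> (proj B e)"
    and Aut_linear: "x \<in> points (base B) \<Longrightarrow> linear_between K (fiber B x) (fiber B (\<psi> x)) \<phi>"
  using assms by (simp_all add: Aut_def)

lemma
  assumes "f \<in> Diff A"
  shows Diff_bij: "bij_betw f (points A) (points A)" and Diff_smooth: "smooth_map A A f"
    and Diff_smooth_inv: "smooth_map A A (inv_into (points A) f)"
  using assms by (simp_all add: Diff_def Bij_def)

lemma base_group_closed:
  assumes "g \<in> base_group K B" "x \<in> points (base B)"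
  shows "g x \<in> points (base B)"
proof -
  obtain \<phi> where "(\<phi>, g) \<in> Aut K B" using assms(1) by (auto simp: base_group_def)
  then show ?thesis using Diff_bij[OF Aut_base] assms(2) bij_betwE by blast
qed

text \<open>The isomorphism is \<open>\<phi>\<close> restricted to a fibre: linear by definition of
  \<open>Aut\<close>, and smooth with its inverse as restrictions of smooth maps. That the inverse
  returns to the fibre over \<open>x\<close> rests on injectivity of \<open>\<psi>\<close>.\<close>

lemma Aut_fiber_isomorphic:
  assumes B: "vector_pseudo_bundle K KD B" and Aut: "(\<phi>, \<psi>) \<in> Aut K B" and x: "x \<in> points (base B)"
  shows "dvs_isomorphic K (fiber B x) (fiber_space B x) (fiber B (\<psi> x)) (fiber_space B (\<psi> x))"
proof -
  let ?E = "points (total B)" and ?g = "inv_into (points (total B)) \<phi>"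
  note bij = Diff_bij[OF Aut_total[OF Aut]] and bij' = Diff_bij[OF Aut_base[OF Aut]]
  have y: "\<psi> x \<in> points (base B)" using bij' x bij_betwE by blast
  note W = vpb_fiber[OF B y]
  have phi: "\<phi> \<in> carrier (fiber B x) \<rightarrow> carrier (fiber B (\<psi> x))"
    using Aut_linear[OF Aut x] by (simp add: linear_between_def)
  have left: "?g (\<phi> e) = e" if "e \<in> ?E" for e by (rule bij_betw_inv_into_left[OF bij that])
  have right: "\<phi> (?g e) = e" if "e \<in> ?E" for e by (rule bij_betw_inv_into_right[OF bij that])
  have inv: "?g \<in> carrier (fiber B (\<psi> x)) \<rightarrow> carrier (fiber B x)"
  proof
    fix e assume "e \<in> carrier (fiber B (\<psi> x))"
    then have e: "e \<in> ?E" "proj B e = \<psi> x" by (simp_all add: carrier_fiber)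
    have ge: "?g e \<in> ?E" using bij_betw_inv_into[OF bij] e(1) bij_betwE by blast
    then have "\<psi> (proj B (?g e)) = \<psi> x" using Aut_proj[OF Aut ge] right e by simp
    moreover have "proj B (?g e) \<in> points (base B)" using vpb_surj[OF B] ge by blast
    ultimately have "proj B (?g e) = x"
      using bij' x by (simp add: bij_betw_def inj_on_def)
    then show "?g e \<in> carrier (fiber B x)" using ge by (simp add: carrier_fiber)
  qed
  show ?thesis
    unfolding dvs_isomorphic_iff[OF dvs_plots[OF W] dvs_points[OF W]]
  proof (intro exI conjI ballI)
    show "smooth_map (fiber_space B x) (fiber_space B (\<psi> x)) \<phi>"
      unfolding fiber_space_def
      by (rule smooth_map_subspace[OF Diff_smooth[OF Aut_total[OF Aut]] phi])
    show "smooth_map (fiber_space B (\<psi> x)) (fiber_space B x) ?g"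
      unfolding fiber_space_def
      by (rule smooth_map_subspace[OF Diff_smooth_inv[OF Aut_total[OF Aut]] inv])
  qed (use left right inv Aut_linear[OF Aut x] in \<open>auto simp: carrier_fiber\<close>)
qed

section \<open>Orbit maps of plots of the base group\<close>

lemma base_group_sub_eval:
  assumes "vector_pseudo_bundle K KD B" "(n, U, g) \<in> plots (base_group_sub K B)" "x \<in> points (base B)"
  shows "(n, U, \<lambda>u\<in>U. g u x) \<in> plots (base B)"
proof (rule Diff_space_eval_plot[OF vpb_base[OF assms(1)] _ assms(3)])
  show "(n, U, g) \<in> plots (Diff_space (base B))"
    using assms(2) by (simp add: base_group_sub_def subspace_diff_def)
qed

lemma Aut_space_params:
  assumes "(n, U, q) \<in> plots (Aut_space K B)"
  shows "(n, U, compose U snd q) \<in> params (base_group K B)"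
proof -
  have "(n, U, q) \<in> params (Aut K B)"
    using assms by (simp add: Aut_space_def pullback_diff_def)
  then show ?thesis
    by (auto simp: in_params base_group_def compose_def PiE_iff)
qed

text \<open>Plots of the quotient are generated by those of \<open>Aut K B\<close>, so the
  automorphisms are evaluated upstairs: they move a point \<open>e\<close> over \<open>x\<close>
  along a plot of the total space, whose projection is the orbit map of \<open>x\<close>.\<close>

lemma base_group_quot_eval:
  assumes B: "vector_pseudo_bundle K KD B" and g: "(n, U, g) \<in> plots (base_group_quot K B)"
    and x: "x \<in> points (base B)"
  shows "(n, U, \<lambda>u\<in>U. g u x) \<in> plots (base B)"
proof -
  \<comment> \<open>Pulling back along evaluation at \<open>x\<close> singles out the families of
    base maps whose orbit map at \<open>x\<close> is a plot; minimality of the push-forward reduces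
    the claim to its generators.\<close>
  define D where "D = pullback_diff (base_group K B) (\<lambda>g. g x) (base B)"
  have "x \<in> proj B ` points (total B)" using vpb_surj[OF B] x by simp
  then obtain e where e: "e \<in> points (total B)" "proj B e = x" by auto
  have "diffeological_space D"
    unfolding D_def
    by (rule diffeological_space_pullback[OF vpb_base[OF B]]) (auto intro: base_group_closed x)
  moreover have "{(n, U, compose U snd q) | n U q. (n, U, q) \<in> plots (Aut_space K B)} \<subseteq> plots D"
  proof clarify
    fix n U q assume q: "(n, U, q) \<in> plots (Aut_space K B)"
    then have "(n, U, compose U fst q) \<in> plots (Diff_space (total B))"
      and qA: "\<And>u. u \<in> U \<Longrightarrow> q u \<in> Aut K B"
      by (auto simp: Aut_space_def pullback_diff_def in_params PiE_iff)
    from Diff_space_eval_plot[OF vpb_total[OF B] this(1) e(1)]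
    have "(n, U, compose U (proj B) (\<lambda>u\<in>U. compose U fst q u e)) \<in> plots (base B)"
      by (rule smooth_map_plot[OF vpb_proj[OF B]])
    moreover have "compose U (proj B) (\<lambda>u\<in>U. compose U fst q u e) =
        compose U (\<lambda>g. g x) (compose U snd q)"
    proof (rule compose_eqI)
      fix u assume u: "u \<in> U"
      have "proj B (fst (q u) e) = snd (q u) x"
        using Aut_proj[of "fst (q u)" "snd (q u)" K B e] qA[OF u] e by simp
      then show "proj B ((\<lambda>u\<in>U. compose U fst q u e) u) = compose U snd q u x"
        using u by (simp add: compose_def)
    qed
    ultimately show "(n, U, compose U snd q) \<in> plots D"
      using Aut_space_params[OF q] by (simp add: D_def pullback_diff_def)
  qed
  ultimately have "plots (base_group_quot K B) \<subseteq> plots D"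
    unfolding base_group_quot_def pushforward_diff_def
    by (intro plots_generated_diff_subset) (auto simp: D_def pullback_diff_def)
  then have "(n, U, compose U (\<lambda>g. g x) g) \<in> plots (base B)"
    using g by (auto simp: D_def pullback_diff_def)
  then show ?thesis by (simp add: compose_def)
qed

lemma
  shows points_base_group_sub: "points (base_group_sub K B) = base_group K B"
    and points_base_group_quot: "points (base_group_quot K B) = base_group K B"
  by (simp_all add: base_group_sub_def subspace_diff_def base_group_quot_def pushforward_diff_def)

lemma base_group_sub_params: "plots (base_group_sub K B) \<subseteq> params (base_group K B)"
  by (simp add: base_group_sub_def subspace_diff_def)

lemma base_group_quot_params: "plots (base_group_quot K B) \<subseteq> params (base_group K B)"
proof -
  have "diffeological_space (base_group_quot K B)"
    unfolding base_group_quot_def pushforward_diff_def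
    by (rule diffeological_space_generated) (use Aut_space_params in blast)
  then show ?thesis
    using points_base_group_quot[of K B] by (metis diffeological_space_def)
qed

section \<open>The pseudo-bundle over the action diffeology\<close>

lemma fiber_Aut_bundle: "fiber (Aut_bundle B G) x = fiber B x"
  by (simp add: fiber_def Aut_bundle_def Let_def)

text \<open>The typing condition of the pullback is absorbed, as plots of the total space already
  satisfy it.\<close>

lemma plots_total_Aut_bundle:
  "diffeological_space (total B) \<Longrightarrow> (n, U, p) \<in> plots (total (Aut_bundle B G)) \<longleftrightarrow>
    (n, U, p) \<in> plots (total B) \<and>
    (n, U, compose U (proj B) p) \<in> plots (action_diff G (\<lambda>g x. g x) (points (base B)))"
  using plot_in_params by (auto simp: Aut_bundle_def Let_def pullback_diff_def)

lemma
  shows points_total_Aut_bundle: "points (total (Aut_bundle B G)) = points (total B)"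
    and base_Aut_bundle: "base (Aut_bundle B G) = action_diff G (\<lambda>g x. g x) (points (base B))"
    and proj_Aut_bundle: "proj (Aut_bundle B G) = proj B"
    and fib_smult_Aut_bundle: "fib_smult (Aut_bundle B G) = fib_smult B"
    and fib_add_Aut_bundle: "fib_add (Aut_bundle B G) = fib_add B"
  by (simp_all add: Aut_bundle_def Let_def)

lemmas Aut_bundle_simps = points_total_Aut_bundle base_Aut_bundle proj_Aut_bundle
  fib_smult_Aut_bundle fib_add_Aut_bundle fiber_Aut_bundle

text \<open>A plot with values in one fibre projects to a constant, which lies in every diffeology on
  the base, so the fibres keep their diffeology.\<close>

lemma fiber_space_Aut_bundle:
  assumes E: "diffeological_space (total B)"
    and X': "diffeological_space (action_diff G (\<lambda>g x. g x) (points (base B)))"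
    and x: "x \<in> points (base B)"
  shows "fiber_space (Aut_bundle B G) x = fiber_space B x"
proof -
  let ?S = "carrier (fiber B x)"
  have "t \<in> plots (total (Aut_bundle B G)) \<longleftrightarrow> t \<in> plots (total B)" if t: "t \<in> params ?S" for t
  proof -
    obtain n U p where tp: "t = (n, U, p)" by (cases t)
    have U: "openin (Euclidean_space n) U" "\<And>u. u \<in> U \<Longrightarrow> proj B (p u) = x"
      using t by (auto simp: tp in_params PiE_iff carrier_fiber)
    have "compose U (proj B) p = (\<lambda>u\<in>U. x)"
      using U(2) by (auto simp: compose_def restrict_def)
    then have "(n, U, compose U (proj B) p) \<in> plots (action_diff G (\<lambda>g x. g x) (points (base B)))"
      using plot_const[OF X' U(1)] x by simp
    then show ?thesis by (simp add: tp plots_total_Aut_bundle[OF E])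
  qed
  then show ?thesis
    by (auto simp: fiber_space_def subspace_diff_def fiber_Aut_bundle)
qed

text \<open>The operations stay smooth because each result lies over the same base point as its
  vector arguments, so the projection condition is inherited. For the subduction,
  \<open>eval\<close> gives access to lifts in the original bundle, which turn out to satisfy the
  projection condition too.\<close>

lemma vector_pseudo_bundle_Aut_bundle:
  assumes K: "diffeological_field K KD" and B: "vector_pseudo_bundle K KD B"
    and G: "plots G \<subseteq> params (points G)"
    and closed: "\<And>g x. g \<in> points G \<Longrightarrow> x \<in> points (base B) \<Longrightarrow> g x \<in> points (base B)"
    and eval: "\<And>n U g x. (n, U, g) \<in> plots G \<Longrightarrow> x \<in> points (base B) \<Longrightarrow>
      (n, U, \<lambda>u\<in>U. g u x) \<in> plots (base B)"
  shows "vector_pseudo_bundle K KD (Aut_bundle B G)"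
proof -
  let ?B = "Aut_bundle B G" and ?X = "points (base B)"
  let ?X' = "action_diff G (\<lambda>g x. g x) ?X"
  note E = vpb_total[OF B]
  note pl = plots_total_Aut_bundle[OF E]
  have X': "diffeological_space ?X'"
    by (rule diffeological_space_action_diff[OF G closed])
  have projX: "proj B \<in> points (total B) \<rightarrow> ?X" using vpb_surj[OF B] by blast
  have E': "diffeological_space (total ?B)"
    using diffeological_space_Int[OF E diffeological_space_pullback[OF X', of "proj B" "points (total B)"]]
      projX by (simp add: Aut_bundle_def Let_def pullback_diff_def)
  have proj': "smooth_map (total ?B) ?X' (proj B)"
    using projX pl by (intro smooth_mapI) (auto simp: Aut_bundle_simps)
  have sub: "plots ?X' \<subseteq> plots (base B)"
    using eval by (intro plots_action_diff_subset[OF vpb_base[OF B]])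
  have "plots (pushforward_diff (total ?B) (proj B) ?X) = plots ?X'"
  proof
    show "plots (pushforward_diff (total ?B) (proj B) ?X) \<subseteq> plots ?X'"
      unfolding pushforward_diff_def
      by (rule plots_generated_diff_subset[OF X']) (use pl in auto)
    define P where "P = pushforward_diff (total ?B) (proj B) ?X"
    have gen: "(n, U, compose U (proj B) q) \<in> plots P" if "(n, U, q) \<in> plots (total ?B)" for n U q
      using that unfolding P_def pushforward_diff_def
      by (intro subsetD[OF generated_diff_superset]) blast
    have P: "diffeological_space P"
      unfolding P_def pushforward_diff_def
    proof (rule diffeological_space_generated, clarify)
      fix n U q assume "(n, U, q) \<in> plots (total ?B)"
      then show "(n, U, compose U (proj B) q) \<in> params ?X"
        using smooth_map_plot[OF proj'] plot_in_params[OF X'] by fastforce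
    qed
    have "t \<in> plots P" if t: "t \<in> plots ?X'" for t
    proof -
      obtain n U p where tp: "t = (n, U, p)" by (cases t)
      have p: "(n, U, p) \<in> plots ?X'" using t tp by simp
      have "(n, U, p) \<in> plots P"
      proof (rule plot_local[OF P])
        show "(n, U, p) \<in> params (points P)"
          using plot_in_params[OF X' p] by (simp add: P_def pushforward_diff_def)
        fix u assume u: "u \<in> U"
        \<comment> \<open>The original base is this push-forward, so a plot of the finer base
          \<open>?X'\<close> has local lifts to the original total space.\<close>
        have "(n, U, p) \<in> plots (pushforward_diff (total B) (proj B) ?X)"
          using p sub vpb_subduction[OF B] by auto
        then obtain V q where V: "V \<subseteq> U" "openin (Euclidean_space n) V" "u \<in> V"
          "(n, V, q) \<in> plots (total B)" "restrict p V = compose V (proj B) q"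
          using pushforward_plot_local_lift[OF E vpb_surj[OF B] _ u] by blast
        \<comment> \<open>The projection of \<open>q\<close> is a restriction of \<open>p\<close>,
          hence a plot of \<open>?X'\<close>; this places the lift in the smaller diffeology of
          \<open>total ?B\<close>.\<close>
        have "(n, V, restrict p V) \<in> plots ?X'"
          by (rule plot_restrict[OF X' p V(2,1)])
        then have "(n, V, q) \<in> plots (total ?B)" using V by (simp add: pl)
        then show "\<exists>V\<subseteq>U. openin (Euclidean_space n) V \<and> u \<in> V \<and> (n, V, restrict p V) \<in> plots P"
          using gen V by metis
      qed
      then show ?thesis by (simp add: tp)
    qed
    then show "plots ?X' \<subseteq> plots (pushforward_diff (total ?B) (proj B) ?X)"
      by (auto simp: P_def)
  qed
  then have subduction: "?X' = pushforward_diff (total ?B) (proj B) ?X"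
    by (intro diffspace.equality) (auto simp: pushforward_diff_def)
  \<comment> \<open>The fibre over \<open>proj B e\<close> is closed under scalars, so the result
    stays over the same point; \<open>fib_add\<close> below is the analogue for sums.\<close>
  have fib: "fib_smult B a e \<in> points (total B) \<and> proj B (fib_smult B a e) = proj B e"
    if "a \<in> carrier K" "e \<in> points (total B)" for a e
  proof -
    have "proj B e \<in> ?X" using projX that by blast
    then interpret M: module K "fiber B (proj B e)" using dvs_module[OF vpb_fiber[OF B]] by blast
    show ?thesis
      using M.smult_closed[of a e] that by (simp add: fiber_def)
  qed
  have fib_add: "fib_add B e e' \<in> points (total B) \<and> proj B (fib_add B e e') = proj B e"
    if "e \<in> points (total B)" "e' \<in> points (total B)" "proj B e = proj B e'" for e e'
  proof -
    have "proj B e \<in> ?X" using projX that by blast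
    then interpret M: module K "fiber B (proj B e)" using dvs_module[OF vpb_fiber[OF B]] by blast
    show ?thesis
      using M.add.m_closed[of e e'] that by (simp add: fiber_def)
  qed
  have smult: "smooth_map (prod_diff KD (total ?B)) (total ?B) (\<lambda>(a, e). fib_smult B a e)"
  proof (rule smooth_mapI)
    have KD: "points KD = carrier K" using K by (simp add: diffeological_field_def)
    show "(\<lambda>(a, e). fib_smult B a e) \<in> points (prod_diff KD (total ?B)) \<rightarrow> points (total ?B)"
      using fib by (auto simp: prod_diff_def Aut_bundle_simps KD)
    fix n U p assume p: "(n, U, p) \<in> plots (prod_diff KD (total ?B))"
    then have par: "(n, U, p) \<in> params (points KD \<times> points (total B))"
      and a: "(n, U, compose U fst p) \<in> plots KD" and e: "(n, U, compose U snd p) \<in> plots (total ?B)"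
      by (auto simp: prod_diff_def Aut_bundle_simps)
    have "(n, U, compose U (\<lambda>(a, e). fib_smult B a e) p) \<in> plots (total B)"
      by (rule smooth_map_plot[OF vpb_smult[OF B]]) (use par a e in \<open>simp add: prod_diff_def pl\<close>)
    \<comment> \<open>Scaling does not move the base point, so the projection is that of the vector
      component, already a plot of \<open>?X'\<close>.\<close>
    moreover have "compose U (proj B) (compose U (\<lambda>(a, e). fib_smult B a e) p) =
        compose U (proj B) (compose U snd p)"
    proof (rule compose_eqI)
      fix u assume u: "u \<in> U"
      then have "fst (p u) \<in> carrier K" "snd (p u) \<in> points (total B)"
        using par KD by (auto simp: in_params PiE_iff mem_Times_iff)
      then show "proj B (compose U (\<lambda>(a, e). fib_smult B a e) p u) = proj B (compose U snd p u)"
        using u fib by (simp add: compose_def split_beta)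
    qed
    ultimately show "(n, U, compose U (\<lambda>(a, e). fib_smult B a e) p) \<in> plots (total ?B)"
      using e by (simp add: pl)
  qed
  have add: "smooth_map (fiber_product ?B) (total ?B) (\<lambda>(e, e'). fib_add B e e')"
  proof (rule smooth_mapI)
    let ?S = "{(e, e'). e \<in> points (total B) \<and> e' \<in> points (total B) \<and> proj B e = proj B e'}"
    show "(\<lambda>(e, e'). fib_add B e e') \<in> points (fiber_product ?B) \<rightarrow> points (total ?B)"
      using fib_add by (auto simp: fiber_product_def subspace_diff_def Aut_bundle_simps)
    fix n U p assume p: "(n, U, p) \<in> plots (fiber_product ?B)"
    then have par: "(n, U, p) \<in> params (points (total B) \<times> points (total B))" "(n, U, p) \<in> params ?S"
      and e: "(n, U, compose U fst p) \<in> plots (total ?B)" "(n, U, compose U snd p) \<in> plots (total ?B)"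
      by (auto simp: fiber_product_def subspace_diff_def prod_diff_def Aut_bundle_simps)
    have "(n, U, compose U (\<lambda>(e, e'). fib_add B e e') p) \<in> plots (total B)"
      by (rule smooth_map_plot[OF vpb_add[OF B]])
        (use par e in \<open>simp add: fiber_product_def subspace_diff_def prod_diff_def pl\<close>)
    \<comment> \<open>Either summand has the same projection as the sum; the first is taken.\<close>
    moreover have "compose U (proj B) (compose U (\<lambda>(e, e'). fib_add B e e') p) =
        compose U (proj B) (compose U fst p)"
    proof (rule compose_eqI)
      fix u assume u: "u \<in> U"
      then have "p u \<in> ?S" using par(2) by (auto simp: in_params PiE_iff)
      then show "proj B (compose U (\<lambda>(e, e'). fib_add B e e') p u) = proj B (compose U fst p u)"
        using u fib_add by (auto simp: compose_def)
    qed
    ultimately show "(n, U, compose U (\<lambda>(e, e'). fib_add B e e') p) \<in> plots (total ?B)"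
      using e by (simp add: pl)
  qed
  show ?thesis
    unfolding vector_pseudo_bundle_def Aut_bundle_simps points_action_diff
    using fiber_space_Aut_bundle[OF E X'] vpb_fiber[OF B]
    by (intro conjI E' X' proj' subduction smult add vpb_surj[OF B]) simp
qed

section \<open>Connected components and invariant sets\<close>

text \<open>A connected set containing \<open>x\<close> and \<open>y\<close> cannot meet both parts
  of a partition of the space into two open sets.\<close>

lemma connected_component_of_clopen:
  assumes "connected_component_of T x y" "openin T S" "openin T (topspace T - S)" "x \<in> S"
  shows "y \<in> S"
proof (rule ccontr)
  assume "y \<notin> S"
  obtain C where C: "connectedin T C" "x \<in> C" "y \<in> C"
    using assms(1) by (auto simp: connected_component_of_def)
  then have "C \<subseteq> topspace T" by (simp add: connectedin)
  then have "C \<subseteq> S \<union> (topspace T - S)" "S \<inter> (topspace T - S) \<inter> C = {}"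
    "S \<inter> C \<noteq> {}" "(topspace T - S) \<inter> C \<noteq> {}"
    using C \<open>y \<notin> S\<close> assms(4) by auto
  then show False using C(1) assms(2,3) unfolding connectedin by blast
qed

text \<open>The preimage of all of \<open>points A\<close> under a plot is its domain, which is
  open.\<close>

lemma topspace_D_topology:
  assumes "diffeological_space A"
  shows "topspace (D_topology A) = points A"
proof -
  have "openin (D_topology A) (points A)"
    unfolding openin_D_topology
  proof (intro conjI ballI, simp, clarify)
    fix n U p assume "(n, U, p) \<in> plots A"
    then have U: "openin (Euclidean_space n) U" and "{u \<in> U. p u \<in> points A} = U"
      using plot_in_params[OF assms] by (auto simp: in_params PiE_iff)
    then show "openin (Euclidean_space n) {u \<in> U. p u \<in> points A}" by simp
  qed
  then show ?thesis using openin_D_topology openin_subset openin_topspace by (metis subset_antisym)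
qed

text \<open>By the pullback condition, a plot of the new total space projects to a plot of the
  action diffeology, where preimages of invariant sets are open.\<close>

lemma openin_D_topology_Aut_bundle:
  assumes E: "diffeological_space (total B)" and G: "plots G \<subseteq> params (points G)"
    and closed: "\<And>g x. g \<in> points G \<Longrightarrow> x \<in> points (base B) \<Longrightarrow> g x \<in> points (base B)"
    and inv: "\<And>g x. g \<in> points G \<Longrightarrow> x \<in> points (base B) \<Longrightarrow> g x \<in> S \<longleftrightarrow> x \<in> S"
  shows "openin (D_topology (total (Aut_bundle B G))) {e \<in> points (total B). proj B e \<in> S}"
  unfolding openin_D_topology
proof (intro conjI ballI, simp add: Aut_bundle_simps, clarify)
  fix n U p assume p: "(n, U, p) \<in> plots (total (Aut_bundle B G))"
  then have p': "(n, U, compose U (proj B) p) \<in> plots (action_diff G (\<lambda>g x. g x) (points (base B)))"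
    and par: "(n, U, p) \<in> params (points (total B))"
    using plots_total_Aut_bundle[OF E] plot_in_params[OF E] by blast+
  have "openin (Euclidean_space n) {u \<in> U. compose U (proj B) p u \<in> S}"
    by (rule action_diff_open_invariant[where act = "\<lambda>g x. g x", OF G _ _ p']) (fact closed inv)+
  moreover have "{u \<in> U. compose U (proj B) p u \<in> S} = {u \<in> U. p u \<in> {e \<in> points (total B). proj B e \<in> S}}"
    using par by (auto simp: compose_def in_params PiE_iff)
  ultimately show "openin (Euclidean_space n) {u \<in> U. p u \<in> {e \<in> points (total B). proj B e \<in> S}}" by simp
qed

theorem proposition4p5:
  fixes K :: "('k, 'm) ring_scheme"
    and KD :: "'k diffspace"
    and B :: "('k, 'e, 'x) pseudo_bundle"
    and G :: "('x \<Rightarrow> 'x) diffspace"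
  assumes "diffeological_field K KD"
    and "vector_pseudo_bundle K KD B"
    and "G = base_group_sub K B \<or> G = base_group_quot K B"
  shows "vector_pseudo_bundle K KD (Aut_bundle B G) \<and>
    (\<forall>x\<in>points (base B). \<forall>y\<in>points (base B).
       (\<exists>e\<in>carrier (fiber (Aut_bundle B G) x). \<exists>f\<in>carrier (fiber (Aut_bundle B G) y).
          connected_component_of (D_topology (total (Aut_bundle B G))) e f) \<longrightarrow>
       dvs_isomorphic K
         (fiber (Aut_bundle B G) x) (fiber_space (Aut_bundle B G) x)
         (fiber (Aut_bundle B G) y) (fiber_space (Aut_bundle B G) y))"
proof -
  \<comment> \<open>Both diffeologies on the group enter the argument only through its points, the
    typing of its plots and the orbit maps.\<close>
  have G: "points G = base_group K B" "plots G \<subseteq> params (points G)"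
    and eval: "\<And>n U g x. (n, U, g) \<in> plots G \<Longrightarrow> x \<in> points (base B) \<Longrightarrow>
      (n, U, \<lambda>u\<in>U. g u x) \<in> plots (base B)"
    using assms(3) points_base_group_sub points_base_group_quot
      base_group_sub_params base_group_quot_params
      base_group_sub_eval[OF assms(2)] base_group_quot_eval[OF assms(2)] by metis+
  note closed = base_group_closed[of _ K B, folded G(1)]
  have vpb: "vector_pseudo_bundle K KD (Aut_bundle B G)"
    by (rule vector_pseudo_bundle_Aut_bundle[OF assms(1,2) G(2)]) (fact closed eval)+
  have X': "diffeological_space (action_diff G (\<lambda>g x. g x) (points (base B)))"
    using vpb_base[OF vpb] by (simp add: base_Aut_bundle)
  note E = vpb_total[OF assms(2)]
  note fs = fiber_space_Aut_bundle[OF E X']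
  define iso where "iso x y \<longleftrightarrow>
    dvs_isomorphic K (fiber B x) (fiber_space B x) (fiber B y) (fiber_space B y)" for x y
  have fib: "diffeological_vector_space K KD (fiber B x) (fiber_space B x)"
    if "x \<in> points (base B)" for x
    by (rule vpb_fiber[OF assms(2) that])
  have "iso x y" if x: "x \<in> points (base B)" and y: "y \<in> points (base B)"
    and e: "e \<in> carrier (fiber B x)" and f: "f \<in> carrier (fiber B y)"
    and ef: "connected_component_of (D_topology (total (Aut_bundle B G))) e f" for x y e f
  proof -
    define S where "S = {z \<in> points (base B). iso x z}"
    have inv: "g z \<in> S \<longleftrightarrow> z \<in> S" if g: "g \<in> points G" and z: "z \<in> points (base B)" for g z
    proof -
      obtain \<phi> where "(\<phi>, g) \<in> Aut K B" using g G(1) by (auto simp: base_group_def)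
      then have "iso z (g z)" using Aut_fiber_isomorphic[OF assms(2) _ z] by (simp add: iso_def)
      moreover have gz: "g z \<in> points (base B)" by (rule closed[OF g z])
      \<comment> \<open>The reverse isomorphism serves the implication from
        \<open>g z \<in> S\<close> to \<open>z \<in> S\<close>.\<close>
      moreover have "iso (g z) z"
        using calculation unfolding iso_def by (intro dvs_isomorphic_sym[OF fib[OF z] fib[OF gz]])
      ultimately show ?thesis
        using z dvs_isomorphic_trans[OF fib[OF x] fib[OF z] fib[OF gz]]
          dvs_isomorphic_trans[OF fib[OF x] fib[OF gz] fib[OF z]]
        unfolding S_def iso_def by blast
    qed
    let ?T = "D_topology (total (Aut_bundle B G))"
    let ?P = "\<lambda>S. {e \<in> points (total B). proj B e \<in> S}"
    have top: "topspace ?T = points (total B)"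
      using topspace_D_topology[OF vpb_total[OF vpb]] by (simp add: points_total_Aut_bundle)
    have "openin ?T (?P S)"
      by (rule openin_D_topology_Aut_bundle[OF E G(2)]) (fact closed inv)+
    \<comment> \<open>The complement of an invariant set is invariant. It is taken in the whole
      type, and \<open>?P\<close> cuts it down to the complement of \<open>?P S\<close> in the total
      space.\<close>
    moreover have "openin ?T (?P (- S))"
      by (rule openin_D_topology_Aut_bundle[OF E G(2)]) (simp_all add: closed inv)
    moreover have "topspace ?T - ?P S = ?P (- S)" unfolding top by blast
    moreover have "iso x x" unfolding iso_def by (rule dvs_isomorphic_refl[OF fib[OF x]])
    then have "e \<in> ?P S" using e x by (simp add: S_def carrier_fiber)
    ultimately have "f \<in> ?P S" using connected_component_of_clopen[OF ef, of "?P S"] by simp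
    then show ?thesis using f by (simp add: S_def carrier_fiber)
  qed
  \<comment> \<open>The new bundle keeps the fibres and their diffeologies, so an isomorphism of the
    original fibres is what is required.\<close>
  then show ?thesis
    using vpb by (auto simp: fiber_Aut_bundle fs iso_def)
qed

end
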